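(* Every twisted spreading model of $Z(\mathcal T)$ is isomorphic to the Kalton-Peck space $Z_2$.
   Context: $\omega$ is the space of all complex sequences with pointwise convergence; $c_{00}$ is the space of finitely supported sequences. Consecutive blocks are finitely supported vectors $u_1,u_2,\dots$ with $\max\operatorname{supp}u_j<\min\operatorname{supp}u_{j+1}$. Tsirelson's space. For $x\in c_{00}$ let $\|x\|_0=\max_j|x_j|$ and $\|x\|_{n+1}=\max\{\|x\|_n,\frac12\max\sum_{j=1}^k\|A_jx\|_n\}$, where the inner maximum is over all $k$ and finite subsets $k\le A_1<\dots<A_k$ of $\mathbb N$ ($A_j<A_{j+1}$ means $\max A_j<\min A_{j+1}$; $A_jx$ is the restriction of $x$ to $A_j$). $\mathcal T$ is the completion of $c_{00}$ under $\|x\|=\lim_n\|x\|_n$. The space $Z(X)$, here with $X=\mathcal T$. Let $X$ be a space with a 1-unconditional basis $(e_j)$, regarded as a sequence space in $\omega$ through the basis, with $X^*$ regarded as a sequence space through $x^*\mapsto(x^*(e_j))_j$. Let $\mathbb S=\{z\in\mathbb C:0\le \operatorname{Re}z\le 1\}$. $\mathcal F_\infty(X,X^* )$ is the space of functions $F:\mathbb S\to\omega$, bounded and continuous on $\mathbb S$, analytic in its interior, such that $t\mapsto F(it)\in X$ and $t\mapsto F(1+it)\in X^*$ are bounded and continuous, with norm $\max(\sup_t\|F(it)\|_X,\sup_t\|F(1+it)\|_{X^*})$. The interpolation space $(X,X^* )_{1/2}=\{F(1/2):F\in\mathcal F_\infty(X,X^* )\}$ with the quotient norm equals $\ell_2$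 up to an equivalent norm. Fix a homogeneous selection $x\in\ell_2\mapsto B(x)\in\mathcal F_\infty(X,X^* )$ with $B(x)(1/2)=x$ and $\|B(x)\|\le C\|x\|_2$, and put $\Omega(x)=B(x)'(1/2)\in\omega$. Then $Z(X)=\{(x,y)\in\omega\times\omega: y\in\ell_2,\ x-\Omega(y)\in\ell_2\}$ with the quasi-norm $\|(x,y)\|=\|x-\Omega(y)\|_2+\|y\|_2$ (which is equivalent to a norm). The selection used on finitely supported $u$ with $\|u\|_2=1$ is the following: write $|u|^2=|v|\,|w|$ with $\|v\|_X,\|w\|_{X^*}\le1$ and $\operatorname{supp}u=\operatorname{supp}v=\operatorname{supp}w$ (Lozanovskii factorization) and take $B(u)(z)=u|v|^{1/2-z}|w|^{z-1/2}$ coordinatewise on $\operatorname{supp}u$, extended homogeneously. Kalton-Peck space: $Z_2=\{(x,y)\in\omega\times\omega:\ y\in\ell_2,\ x-\mathcal K(y)\in\ell_2\}$ with $\|(x,y)\|_{Z_2}=\|x-\mathcal K(y)\|_2+\|y\|_2$, where $\mathcal K(y)=\sum_j y_j\log|y_j|\,e_j$ for $\|y\|_2=1$ (with $0\log 0=0$), extended homogeneously. Twisted spreading model of $Z(X)$ (with centralizer $\Omega$): let $(u_j)$ be a sequence of normalized consecutive blocks in $\ell_2$ such that (after passing to a subsequence; this is always possible) for every $n$ and all scalars $a_1,\dots,a_n,b_1,\dots,b_n$ the limit $$\lim_{\nu\to\infty,\ \nu<k_1<\dots<k_n}\Big(\Big\|\sum_{j=1}^n a_ju_{k_j}+\sum_{j=1}^n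 b_j\Omega(u_{k_j})-\Omega\Big(\sum_{j=1}^n b_ju_{k_j}\Big)\Big\|_2+\Big\|\sum_{j=1}^n b_ju_{k_j}\Big\|_2\Big)$$ exists. The completion of $c_{00}\times c_{00}$ under the quasi-norm $\|(a,b)\|$ given by this limit is a twisted spreading model of $Z(X)$. *)

theory Defs
  imports "HOL-Complex_Analysis.Complex_Analysis"
begin

section \<open>Complex quasi-normed spaces\<close>

record 'a qnspace =
  qcarrier :: "'a set"
  qadd :: "'a \<Rightarrow> 'a \<Rightarrow> 'a"
  qscale :: "complex \<Rightarrow> 'a \<Rightarrow> 'a"
  qnorm :: "'a \<Rightarrow> real"

definition qn_isomorphic :: "'a qnspace \<Rightarrow> 'b qnspace \<Rightarrow> bool" where
  "qn_isomorphic V W \<longleftrightarrow> (\<exists>T. bij_betw T (qcarrier V) (qcarrier W)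
     \<and> (\<forall>x\<in>qcarrier V. \<forall>y\<in>qcarrier V. T (qadd V x y) = qadd W (T x) (T y))
     \<and> (\<forall>c. \<forall>x\<in>qcarrier V. T (qscale V c x) = qscale W c (T x))
     \<and> (\<exists>m M. 0 < m \<and> 0 < M \<and>
          (\<forall>x\<in>qcarrier V. m * qnorm V x \<le> qnorm W (T x) \<and> qnorm W (T x) \<le> M * qnorm V x)))"

definition qdist :: "'a qnspace \<Rightarrow> 'a \<Rightarrow> 'a \<Rightarrow> real" where
  "qdist V x y = qnorm V (qadd V x (qscale V (- 1) y))"

definition qCauchy :: "'a qnspace \<Rightarrow> (nat \<Rightarrow> 'a) set" where
  "qCauchy V = {s. (\<forall>n. s n \<in> qcarrier V) \<and>
     (\<forall>e>0. \<exists>M. \<forall>m\<ge>M. \<forall>n\<ge>M. qdist V (s m) (s n) < e)}"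

definition qequiv :: "'a qnspace \<Rightarrow> ((nat \<Rightarrow> 'a) \<times> (nat \<Rightarrow> 'a)) set" where
  "qequiv V = {(s, t). s \<in> qCauchy V \<and> t \<in> qCauchy V \<and>
     (\<lambda>n. qdist V (s n) (t n)) \<longlonglongrightarrow> 0}"

text \<open>The completion consists of the classes of Cauchy sequences. A quasi-norm need not be
  continuous, so the values along a Cauchy sequence need not converge, and their upper limit may
  depend on the representative (up to the modulus of concavity); the quasi-norm of a class is the
  infimum over its representatives of the upper limit. It is the usual limit if the given
  quasi-norm is continuous.\<close>

definition qcompletion :: "'a qnspace \<Rightarrow> (nat \<Rightarrow> 'a) set qnspace" where
  "qcompletion V = \<lparr>
     qcarrier = qCauchy V // qequiv V,
     qadd = (\<lambda>P Q. \<Union>s\<in>P. \<Union>t\<in>Q. qequiv V `` {\<lambda>n. qadd V (s n) (t n)}),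
     qscale = (\<lambda>c P. \<Union>s\<in>P. qequiv V `` {\<lambda>n. qscale V c (s n)}),
     qnorm = (\<lambda>P. Inf {C. \<exists>s\<in>P. \<forall>\<^sub>F n in sequentially. qnorm V (s n) \<le> C})\<rparr>"


section \<open>Sequence spaces\<close>

type_synonym cseq = "nat \<Rightarrow> complex"

definition supp :: "cseq \<Rightarrow> nat set" where
  "supp x = {j. x j \<noteq> 0}"

definition c00 :: "cseq set" where
  "c00 = {x. finite (supp x)}"

definition unit_seq :: "nat \<Rightarrow> cseq" where
  "unit_seq j = (\<lambda>i. if i = j then 1 else 0)"

definition restr :: "nat set \<Rightarrow> cseq \<Rightarrow> cseq" where
  "restr A x = (\<lambda>j. if j \<in> A then x j else 0)"

definition ell2 :: "cseq set" where
  "ell2 = {x. summable (\<lambda>j. (cmod (x j))\<^sup>2)}"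

definition ell2_norm :: "cseq \<Rightarrow> real" where
  "ell2_norm x = sqrt (\<Sum>j. (cmod (x j))\<^sup>2)"

text \<open>A Banach space \<open>X\<close> with a normalized basis is given by its norm \<open>N\<close> on \<open>c00\<close>, i.e. \<open>X\<close> is the
  completion of \<open>c00\<close> under \<open>N\<close>. Identified with a sequence space through the basis, it consists of
  the \<open>x\<close> for which the partial sums of \<open>\<Sum>x\<^sub>j e\<^sub>j\<close> are Cauchy. In the dual, a functional is
  identified with its values on the basis.\<close>

definition seq_space :: "(cseq \<Rightarrow> real) \<Rightarrow> cseq set" where
  "seq_space N = {x. \<forall>e>0. \<exists>M. \<forall>m\<ge>M. \<forall>n\<ge>M.
     N (\<lambda>j. restr {..<m} x j - restr {..<n} x j) < e}"

definition seq_norm :: "(cseq \<Rightarrow> real) \<Rightarrow> cseq \<Rightarrow> real" where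
  "seq_norm N x = lim (\<lambda>n. N (restr {..<n} x))"

definition functional_bounded_by :: "(cseq \<Rightarrow> real) \<Rightarrow> real \<Rightarrow> (cseq \<Rightarrow> complex) \<Rightarrow> bool" where
  "functional_bounded_by N C \<phi> \<longleftrightarrow>
     (\<forall>x\<in>seq_space N. \<forall>y\<in>seq_space N. \<phi> (\<lambda>j. x j + y j) = \<phi> x + \<phi> y) \<and>
     (\<forall>c. \<forall>x\<in>seq_space N. \<phi> (\<lambda>j. c * x j) = c * \<phi> x) \<and>
     (\<forall>x\<in>seq_space N. cmod (\<phi> x) \<le> C * seq_norm N x)"

definition dual_space :: "(cseq \<Rightarrow> real) \<Rightarrow> cseq set" where
  "dual_space N = {y. \<exists>\<phi> C. functional_bounded_by N C \<phi> \<and> (\<forall>j. y j = \<phi> (unit_seq j))}"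

definition dual_norm :: "(cseq \<Rightarrow> real) \<Rightarrow> cseq \<Rightarrow> real" where
  "dual_norm N y = Inf {C. 0 \<le> C \<and>
     (\<exists>\<phi>. functional_bounded_by N C \<phi> \<and> (\<forall>j. y j = \<phi> (unit_seq j)))}"


section \<open>Tsirelson's space\<close>

text \<open>Sequences are indexed from \<open>0\<close>, whereas the condition \<open>k \<le> A\<^sub>1\<close> refers to a basis
  \<open>e\<^sub>1, e\<^sub>2, \<dots>\<close>. Coordinate \<open>i\<close> belongs to \<open>e\<close> with index \<open>Suc i\<close>, so the condition reads
  \<open>k \<le> Suc i\<close> for all \<open>i\<close> in the first set; the sets are \<open>A 0, \<dots>, A (k - 1)\<close>.\<close>

definition admissible :: "nat \<Rightarrow> (nat \<Rightarrow> nat set) \<Rightarrow> bool" where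
  "admissible k A \<longleftrightarrow> 1 \<le> k \<and> (\<forall>j<k. finite (A j) \<and> A j \<noteq> {}) \<and> (\<forall>i\<in>A 0. k \<le> Suc i) \<and>
     (\<forall>j. Suc j < k \<longrightarrow> Max (A j) < Min (A (Suc j)))"

text \<open>For \<open>x \<in> c00\<close> both suprema are over finite sets of values, hence maxima.\<close>

primrec tsirelson_approx :: "nat \<Rightarrow> cseq \<Rightarrow> real" where
  "tsirelson_approx 0 x = (SUP j. cmod (x j))"
| "tsirelson_approx (Suc n) x = max (tsirelson_approx n x)
     (1/2 * Sup {\<Sum>j<k. tsirelson_approx n (restr (A j) x) | k A. admissible k A})"

definition tsirelson_norm :: "cseq \<Rightarrow> real" where
  "tsirelson_norm x = lim (\<lambda>n. tsirelson_approx n x)"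


section \<open>Complex interpolation between \<open>X\<close> and its dual\<close>

definition strip :: "complex set" where
  "strip = {z. 0 \<le> Re z \<and> Re z \<le> 1}"

text \<open>Continuity into \<open>\<omega>\<close> is for the product topology on functions, while boundedness and analyticity
  in \<open>\<omega>\<close> are coordinatewise. (The metric that the library puts on this product is bounded, so
  metric boundedness would be void.)\<close>

definition calF :: "(cseq \<Rightarrow> real) \<Rightarrow> (complex \<Rightarrow> cseq) set" where
  "calF N = {F.
     continuous_on strip F \<and>
     (\<forall>j. bounded ((\<lambda>z. F z j) ` strip)) \<and>
     (\<forall>j. (\<lambda>z. F z j) holomorphic_on interior strip) \<and>
     (\<forall>t::real. F (\<i> * t) \<in> seq_space N) \<and>
     bdd_above (range (\<lambda>t::real. seq_norm N (F (\<i> * t)))) \<and>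
     (\<forall>t::real. ((\<lambda>s::real. seq_norm N (\<lambda>j. F (\<i> * s) j - F (\<i> * t) j)) \<longlongrightarrow> 0) (at t)) \<and>
     (\<forall>t::real. F (1 + \<i> * t) \<in> dual_space N) \<and>
     bdd_above (range (\<lambda>t::real. dual_norm N (F (1 + \<i> * t)))) \<and>
     (\<forall>t::real. ((\<lambda>s::real. dual_norm N (\<lambda>j. F (1 + \<i> * s) j - F (1 + \<i> * t) j)) \<longlongrightarrow> 0) (at t))}"

definition calF_norm :: "(cseq \<Rightarrow> real) \<Rightarrow> (complex \<Rightarrow> cseq) \<Rightarrow> real" where
  "calF_norm N F = max (SUP t::real. seq_norm N (F (\<i> * t))) (SUP t::real. dual_norm N (F (1 + \<i> * t)))"

definition lozanovskii_factorization :: "(cseq \<Rightarrow> real) \<Rightarrow> cseq \<Rightarrow> cseq \<Rightarrow> cseq \<Rightarrow> bool" where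
  "lozanovskii_factorization N u v w \<longleftrightarrow>
     (\<forall>j. (cmod (u j))\<^sup>2 = cmod (v j) * cmod (w j)) \<and>
     v \<in> seq_space N \<and> seq_norm N v \<le> 1 \<and> w \<in> dual_space N \<and> dual_norm N w \<le> 1 \<and>
     supp u = supp v \<and> supp u = supp w"

text \<open>Off the support of \<open>u\<close> the last formula gives \<open>0\<close> because of the factor \<open>u j\<close>.\<close>

definition selection :: "(cseq \<Rightarrow> real) \<Rightarrow> (cseq \<Rightarrow> complex \<Rightarrow> cseq) \<Rightarrow> bool" where
  "selection N B \<longleftrightarrow>
     (\<forall>x\<in>ell2. B x \<in> calF N) \<and>
     (\<forall>x\<in>ell2. \<forall>c. \<forall>z\<in>strip. B (\<lambda>j. c * x j) z = (\<lambda>j. c * B x z j)) \<and>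
     (\<forall>x\<in>ell2. B x (1/2) = x) \<and>
     (\<exists>C. \<forall>x\<in>ell2. calF_norm N (B x) \<le> C * ell2_norm x) \<and>
     (\<forall>u\<in>c00. ell2_norm u = 1 \<longrightarrow> (\<exists>v w. lozanovskii_factorization N u v w \<and>
        (\<forall>z\<in>strip. B u z = (\<lambda>j. u j * complex_of_real (cmod (v j)) powr (1/2 - z)
                                   * complex_of_real (cmod (w j)) powr (z - 1/2)))))"

definition centralizer :: "(cseq \<Rightarrow> complex \<Rightarrow> cseq) \<Rightarrow> cseq \<Rightarrow> cseq" where
  "centralizer B x = (\<lambda>j. deriv (\<lambda>z. B x z j) (1/2))"


section \<open>Twisted sums and twisted spreading models\<close>

text \<open>With \<open>\<Omega> = centralizer B\<close> for a selection \<open>B\<close> for \<open>X\<close>, this is the space \<open>Z(X)\<close>.\<close>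

definition twisted_sum :: "(cseq \<Rightarrow> cseq) \<Rightarrow> (cseq \<times> cseq) qnspace" where
  "twisted_sum \<Omega> = \<lparr>
     qcarrier = {(x, y). y \<in> ell2 \<and> (\<lambda>j. x j - \<Omega> y j) \<in> ell2},
     qadd = (\<lambda>(x, y) (x', y'). (\<lambda>j. x j + x' j, \<lambda>j. y j + y' j)),
     qscale = (\<lambda>c (x, y). (\<lambda>j. c * x j, \<lambda>j. c * y j)),
     qnorm = (\<lambda>(x, y). ell2_norm (\<lambda>j. x j - \<Omega> y j) + ell2_norm y)\<rparr>"

definition kp_unit :: "cseq \<Rightarrow> cseq" where
  "kp_unit y = (\<lambda>j. y j * complex_of_real (ln (cmod (y j))))"

definition kp :: "cseq \<Rightarrow> cseq" where
  "kp y = (\<lambda>j. complex_of_real (ell2_norm y) *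
             kp_unit (\<lambda>i. y i / complex_of_real (ell2_norm y)) j)"

definition kalton_peck :: "(cseq \<times> cseq) qnspace" where
  "kalton_peck = twisted_sum kp"

definition normalized_blocks :: "(nat \<Rightarrow> cseq) \<Rightarrow> bool" where
  "normalized_blocks u \<longleftrightarrow> (\<forall>j. u j \<in> c00 \<and> ell2_norm (u j) = 1) \<and>
     (\<forall>j. Max (supp (u j)) < Min (supp (u (Suc j))))"

text \<open>The quantity in the limit is the quasi-norm in \<open>Z(X)\<close> of
  \<open>(\<Sum>a\<^sub>j u\<^sub>k\<^sub>j + \<Sum>b\<^sub>j \<Omega>(u\<^sub>k\<^sub>j), \<Sum>b\<^sub>j u\<^sub>k\<^sub>j)\<close>.\<close>

definition twisted_value ::
  "(cseq \<Rightarrow> cseq) \<Rightarrow> (nat \<Rightarrow> cseq) \<Rightarrow> nat \<Rightarrow> cseq \<Rightarrow> cseq \<Rightarrow> (nat \<Rightarrow> nat) \<Rightarrow> real" where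
  "twisted_value \<Omega> u n a b k =
     ell2_norm (\<lambda>i. (\<Sum>j<n. a j * u (k j) i) + (\<Sum>j<n. b j * \<Omega> (u (k j)) i)
                     - \<Omega> (\<lambda>i. \<Sum>j<n. b j * u (k j) i) i)
     + ell2_norm (\<lambda>i. \<Sum>j<n. b j * u (k j) i)"

definition twisted_limit ::
  "(cseq \<Rightarrow> cseq) \<Rightarrow> (nat \<Rightarrow> cseq) \<Rightarrow> nat \<Rightarrow> cseq \<Rightarrow> cseq \<Rightarrow> real \<Rightarrow> bool" where
  "twisted_limit \<Omega> u n a b L \<longleftrightarrow>
     (\<forall>e>0. \<exists>\<nu>. \<forall>k. strict_mono_on {..<n} k \<and> (\<forall>j<n. \<nu> < k j) \<longrightarrow>
        \<bar>twisted_value \<Omega> u n a b k - L\<bar> < e)"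

definition twisted_presp :: "(cseq \<times> cseq \<Rightarrow> real) \<Rightarrow> (cseq \<times> cseq) qnspace" where
  "twisted_presp N = \<lparr>
     qcarrier = c00 \<times> c00,
     qadd = (\<lambda>(x, y) (x', y'). (\<lambda>j. x j + x' j, \<lambda>j. y j + y' j)),
     qscale = (\<lambda>c (x, y). (\<lambda>j. c * x j, \<lambda>j. c * y j)),
     qnorm = N\<rparr>"

text \<open>The block sequence \<open>u\<close> below is the one obtained after passing to a subsequence: all limits are
  required to exist, and they determine \<open>N\<close> on \<open>c00 \<times> c00\<close>.\<close>

definition twisted_spreading_model ::
  "(cseq \<Rightarrow> cseq) \<Rightarrow> (nat \<Rightarrow> cseq \<times> cseq) set qnspace \<Rightarrow> bool" where
  "twisted_spreading_model \<Omega> S \<longleftrightarrow> (\<exists>u N. normalized_blocks u \<and>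
     (\<forall>n a b. supp a \<subseteq> {..<n} \<and> supp b \<subseteq> {..<n} \<longrightarrow> twisted_limit \<Omega> u n a b (N (a, b))) \<and>
     S = qcompletion (twisted_presp N))"

end

theory Submission
  imports Defs
begin

text \<open>On a normalized \<open>u\<close> with factorization \<open>|u|\<^sup>2 = |v| |w|\<close> the centralizer is
  \<open>\<Omega>(u) = u (ln |w| - ln |v|)\<close>. For blocks \<open>u\<^sub>j\<close> with factorizations \<open>v\<^sub>j, w\<^sub>j\<close> far enough to the right and
  \<open>\<Sum>|b\<^sub>j|\<^sup>2 = 1\<close>, compare the factorization \<open>V, W\<close> of \<open>U = \<Sum>b\<^sub>j u\<^sub>j\<close> with the pair \<open>\<Sum>|b\<^sub>j|\<^sup>2 v\<^sub>j\<close>,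
  \<open>\<Sum>w\<^sub>j\<close>, for which \<open>\<Omega>\<close> would be \<open>\<Sum>b\<^sub>j \<Omega>(u\<^sub>j) - 2 \<Sum>b\<^sub>j ln |b\<^sub>j| u\<^sub>j\<close>. With
  \<open>r = |b\<^sub>j|\<^sup>2 |v\<^sub>j| / |V| = |W| / |w\<^sub>j|\<close> on the support of \<open>u\<^sub>j\<close> the difference is \<open>2 U ln r\<close>, and
  \<open>(ln r)\<^sup>2 \<le> 2 (r + 1 / r)\<close> bounds its square by a multiple of
  \<open>\<Sum>|b\<^sub>j|\<^sup>2 \<langle>|v\<^sub>j|, |W|\<rangle> + \<Sum>\<langle>|V|, |w\<^sub>j|\<rangle>\<close>. Duality bounds the first sum by \<open>1\<close> and the second by the sum of
  the norms of the restrictions of \<open>V\<close> to the blocks, hence by \<open>2\<close>, since blocks far to the right are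
  admissible. So the limit quasi-norm is equivalent to \<open>\<parallel>a + 2 K(b)\<parallel> + \<parallel>b\<parallel>\<close>, and
  \<open>(a, b) \<mapsto> (- a / 2, b)\<close> extends to an isomorphism of the completion onto \<open>Z\<^sub>2\<close>, which is complete by
  Fatou's lemma and in which \<open>c\<^sub>0\<^sub>0 \<times> c\<^sub>0\<^sub>0\<close> is dense.\<close>

section \<open>Completions of quasi-normed spaces\<close>

lemma tendsto_0_le_real:
  fixes f g :: "nat \<Rightarrow> real"
  assumes "g \<longlonglongrightarrow> 0" "\<And>n. 0 \<le> f n" "\<And>n. f n \<le> g n"
  shows "f \<longlonglongrightarrow> 0"
  using tendsto_sandwich[of "\<lambda>_. 0" f sequentially g 0] assms by simp

text \<open>A \<open>qnspace\<close> is a bare record without vector space laws, so the laws that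
  completions rely on are stated as relations for \<open>qdist\<close>. One constant
  \<open>K\<close> serves as modulus of concavity in all of them.\<close>

locale complete_qnspace =
  fixes W :: "'b qnspace" and K :: real
  assumes K_ge_1: "1 \<le> K"
    and add_closed: "x \<in> qcarrier W \<Longrightarrow> y \<in> qcarrier W \<Longrightarrow> qadd W x y \<in> qcarrier W"
    and scale_closed: "x \<in> qcarrier W \<Longrightarrow> qscale W c x \<in> qcarrier W"
    and qnorm_nonneg: "x \<in> qcarrier W \<Longrightarrow> 0 \<le> qnorm W x"
    and qdist_eq_0D: "x \<in> qcarrier W \<Longrightarrow> y \<in> qcarrier W \<Longrightarrow> qdist W x y = 0 \<Longrightarrow> x = y"
    and qdist_commute: "x \<in> qcarrier W \<Longrightarrow> y \<in> qcarrier W \<Longrightarrow> qdist W x y = qdist W y x"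
    and qdist_triangle: "x \<in> qcarrier W \<Longrightarrow> y \<in> qcarrier W \<Longrightarrow> z \<in> qcarrier W \<Longrightarrow>
      qdist W x z \<le> K * (qdist W x y + qdist W y z)"
    and qdist_add: "x \<in> qcarrier W \<Longrightarrow> y \<in> qcarrier W \<Longrightarrow> x' \<in> qcarrier W \<Longrightarrow> y' \<in> qcarrier W \<Longrightarrow>
      qdist W (qadd W x y) (qadd W x' y') \<le> K * (qdist W x x' + qdist W y y')"
    and qdist_scale: "x \<in> qcarrier W \<Longrightarrow> y \<in> qcarrier W \<Longrightarrow>
      qdist W (qscale W c x) (qscale W c y) = cmod c * qdist W x y"
    and qnorm_le: "x \<in> qcarrier W \<Longrightarrow> y \<in> qcarrier W \<Longrightarrow> qnorm W x \<le> K * (qnorm W y + qdist W x y)"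
    and complete: "s \<in> qCauchy W \<Longrightarrow> \<exists>z\<in>qcarrier W. (\<lambda>n. qdist W (s n) z) \<longlonglongrightarrow> 0"
begin

lemma qdist_nonneg: "x \<in> qcarrier W \<Longrightarrow> y \<in> qcarrier W \<Longrightarrow> 0 \<le> qdist W x y"
  unfolding qdist_def by (intro qnorm_nonneg add_closed scale_closed)

end

text \<open>Estimates in \<open>V\<close> are carried over to \<open>W\<close> by the two-sided
  bound on \<open>J\<close>; symmetry and the quasi-triangle inequality are then used in
  \<open>W\<close>.\<close>

locale dense_embedding = complete_qnspace W K
  for W :: "'b qnspace" and K +
  fixes V :: "'a qnspace" and J :: "'a \<Rightarrow> 'b" and m M :: real
  assumes m_pos: "0 < m" and M_pos: "0 < M"
    and add_closed': "x \<in> qcarrier V \<Longrightarrow> y \<in> qcarrier V \<Longrightarrow> qadd V x y \<in> qcarrier V"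
    and scale_closed': "x \<in> qcarrier V \<Longrightarrow> qscale V c x \<in> qcarrier V"
    and J_carrier: "x \<in> qcarrier V \<Longrightarrow> J x \<in> qcarrier W"
    and J_add: "x \<in> qcarrier V \<Longrightarrow> y \<in> qcarrier V \<Longrightarrow> J (qadd V x y) = qadd W (J x) (J y)"
    and J_scale: "x \<in> qcarrier V \<Longrightarrow> J (qscale V c x) = qscale W c (J x)"
    and J_lower: "x \<in> qcarrier V \<Longrightarrow> m * qnorm V x \<le> qnorm W (J x)"
    and J_upper: "x \<in> qcarrier V \<Longrightarrow> qnorm W (J x) \<le> M * qnorm V x"
    and dense: "z \<in> qcarrier W \<Longrightarrow> \<exists>s. (\<forall>n. s n \<in> qcarrier V) \<and> (\<lambda>n. qdist W (J (s n)) z) \<longlonglongrightarrow> 0"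
begin

text \<open>These sets turn out to be exactly the classes that form the completion of
  \<open>V\<close>, so \<open>seqs_to\<close> is the inverse of the isomorphism to be built.\<close>

definition seqs_to :: "'b \<Rightarrow> (nat \<Rightarrow> 'a) set" where
  "seqs_to z = {s. (\<forall>n. s n \<in> qcarrier V) \<and> (\<lambda>n. qdist W (J (s n)) z) \<longlonglongrightarrow> 0}"

section \<open>Cauchy sequences in a dense subspace and their classes\<close>

lemma qdist_J:
  assumes "x \<in> qcarrier V" "y \<in> qcarrier V"
  shows "m * qdist V x y \<le> qdist W (J x) (J y)" "qdist W (J x) (J y) \<le> M * qdist V x y"
proof -
  have "qadd V x (qscale V (- 1) y) \<in> qcarrier V"
    using assms by (intro add_closed' scale_closed')
  moreover have "qdist W (J x) (J y) = qnorm W (J (qadd V x (qscale V (- 1) y)))"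
    using assms by (simp add: qdist_def J_add J_scale scale_closed')
  ultimately show "m * qdist V x y \<le> qdist W (J x) (J y)" "qdist W (J x) (J y) \<le> M * qdist V x y"
    using J_lower J_upper by (simp_all add: qdist_def)
qed

lemma qdist_V_nonneg:
  assumes "x \<in> qcarrier V" "y \<in> qcarrier V" shows "0 \<le> qdist V x y"
proof -
  have "0 \<le> qdist W (J x) (J y)" using assms by (intro qdist_nonneg J_carrier)
  also have "\<dots> \<le> M * qdist V x y" using assms by (rule qdist_J(2))
  finally show ?thesis using M_pos by (simp add: zero_le_mult_iff)
qed

lemma qCauchy_J:
  assumes "s \<in> qCauchy V" shows "(\<lambda>n. J (s n)) \<in> qCauchy W"
  unfolding qCauchy_def
proof (intro CollectI conjI allI impI)
  have sV: "s n \<in> qcarrier V" for n using assms by (auto simp: qCauchy_def)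
  show "J (s n) \<in> qcarrier W" for n using sV J_carrier by blast
  fix e :: real assume "e > 0"
  then have "e / M > 0" using M_pos by simp
  then obtain L where L: "\<And>k n. k \<ge> L \<Longrightarrow> n \<ge> L \<Longrightarrow> qdist V (s k) (s n) < e / M"
    using assms unfolding qCauchy_def by blast
  have "qdist W (J (s k)) (J (s n)) < e" if "k \<ge> L" "n \<ge> L" for k n
    using L[OF that] qdist_J(2)[OF sV sV, of k n] M_pos by (simp add: field_simps)
  then show "\<exists>L. \<forall>k\<ge>L. \<forall>n\<ge>L. qdist W (J (s k)) (J (s n)) < e" by blast
qed

lemma seqs_to_qCauchy:
  assumes z: "z \<in> qcarrier W" and s: "s \<in> seqs_to z"
  shows "s \<in> qCauchy V"
  unfolding qCauchy_def
proof (intro CollectI conjI allI impI)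
  have sV: "s n \<in> qcarrier V" for n using s by (auto simp: seqs_to_def)
  then show "s n \<in> qcarrier V" for n .
  fix e :: real assume e: "e > 0"
  \<comment> \<open>Passing through \<open>z\<close> costs two distances and a factor
    \<open>K\<close>; returning from \<open>W\<close> to \<open>V\<close> costs a factor
    \<open>1 / m\<close>.\<close>
  define d where "d = m * e / (2 * K)"
  have d: "d > 0" using e m_pos K_ge_1 by (simp add: d_def)
  have "(\<lambda>n. qdist W (J (s n)) z) \<longlonglongrightarrow> 0" using s by (simp add: seqs_to_def)
  from order_tendstoD(2)[OF this d] obtain L where L: "\<And>n. n \<ge> L \<Longrightarrow> qdist W (J (s n)) z < d"
    unfolding eventually_sequentially by blast
  have "qdist V (s k) (s n) < e" if "k \<ge> L" "n \<ge> L" for k n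
  proof -
    have "m * qdist V (s k) (s n) \<le> qdist W (J (s k)) (J (s n))" using qdist_J(1) sV by blast
    also have "\<dots> \<le> K * (qdist W (J (s k)) z + qdist W z (J (s n)))"
      using sV z J_carrier by (intro qdist_triangle) auto
    also have "\<dots> = K * (qdist W (J (s k)) z + qdist W (J (s n)) z)"
      using qdist_commute[OF z J_carrier[OF sV]] by simp
    also have "\<dots> < K * (2 * d)"
      using L[OF that(1)] L[OF that(2)] K_ge_1 by (intro mult_strict_left_mono) auto
    also have "\<dots> = m * e" using K_ge_1 by (simp add: d_def)
    finally show ?thesis using m_pos by simp
  qed
  then show "\<exists>L. \<forall>k\<ge>L. \<forall>n\<ge>L. qdist V (s k) (s n) < e" by blast
qed

lemma qCauchy_seqs_to:
  assumes "s \<in> qCauchy V" obtains z where "z \<in> qcarrier W" "s \<in> seqs_to z"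
proof -
  have "\<forall>n. s n \<in> qcarrier V" using assms by (auto simp: qCauchy_def)
  then show thesis using complete[OF qCauchy_J[OF assms]] that by (auto simp: seqs_to_def)
qed

text \<open>A quasi-norm need not be continuous, so distances are not passed to the limit. In both
  directions they are bounded by multiples of null sequences through the quasi-triangle
  inequality.\<close>

lemma qequiv_iff_same_limit:
  assumes z: "z \<in> qcarrier W" "z' \<in> qcarrier W" and s: "s \<in> seqs_to z" and t: "t \<in> seqs_to z'"
  shows "(s, t) \<in> qequiv V \<longleftrightarrow> z = z'"
proof -
  have sV: "s n \<in> qcarrier V" "t n \<in> qcarrier V" for n using s t by (auto simp: seqs_to_def)
  have sW: "J (s n) \<in> qcarrier W" "J (t n) \<in> qcarrier W" for n using sV J_carrier by auto
  have lims: "(\<lambda>n. qdist W (J (s n)) z) \<longlonglongrightarrow> 0" "(\<lambda>n. qdist W (J (t n)) z') \<longlonglongrightarrow> 0"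
    using s t by (auto simp: seqs_to_def)
  show ?thesis
  proof
    assume "(s, t) \<in> qequiv V"
    then have d: "(\<lambda>n. qdist V (s n) (t n)) \<longlonglongrightarrow> 0" by (simp add: qequiv_def)
    have le: "qdist W z z' \<le> K * (qdist W (J (s n)) z + K * (M * qdist V (s n) (t n) + qdist W (J (t n)) z'))"
      for n
    proof -
      have "qdist W z z' \<le> K * (qdist W z (J (s n)) + qdist W (J (s n)) z')"
        using z sW by (intro qdist_triangle) auto
      also have "\<dots> = K * (qdist W (J (s n)) z + qdist W (J (s n)) z')"
        using qdist_commute[OF z(1) sW(1)] by simp
      also have "\<dots> \<le> K * (qdist W (J (s n)) z + K * (qdist W (J (s n)) (J (t n)) + qdist W (J (t n)) z'))"
        using z sW K_ge_1 by (intro mult_left_mono add_left_mono qdist_triangle) auto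
      also have "\<dots> \<le> K * (qdist W (J (s n)) z + K * (M * qdist V (s n) (t n) + qdist W (J (t n)) z'))"
        using sV K_ge_1 by (intro mult_left_mono add_left_mono add_right_mono qdist_J(2)) auto
      finally show ?thesis .
    qed
    have "(\<lambda>n. K * (qdist W (J (s n)) z + K * (M * qdist V (s n) (t n) + qdist W (J (t n)) z')))
        \<longlonglongrightarrow> K * (0 + K * (M * 0 + 0))"
      by (intro tendsto_intros lims d)
    then have "qdist W z z' \<le> 0" using le by (intro LIMSEQ_le_const) auto
    then show "z = z'" using qdist_nonneg[OF z] z by (intro qdist_eq_0D) auto
  next
    assume eq: "z = z'"
    have le: "qdist V (s n) (t n) \<le> (K / m) * (qdist W (J (s n)) z + qdist W (J (t n)) z')" for n
    proof -
      have "m * qdist V (s n) (t n) \<le> qdist W (J (s n)) (J (t n))" using qdist_J(1) sV by blast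
      also have "\<dots> \<le> K * (qdist W (J (s n)) z + qdist W z (J (t n)))"
        using sW z by (intro qdist_triangle) auto
      also have "\<dots> = K * (qdist W (J (s n)) z + qdist W (J (t n)) z')"
        using qdist_commute[OF z(1) sW(2)] eq by simp
      finally show ?thesis using m_pos by (simp add: field_simps)
    qed
    have lim: "(\<lambda>n. (K / m) * (qdist W (J (s n)) z + qdist W (J (t n)) z')) \<longlonglongrightarrow> 0"
      using lims m_pos by (auto intro!: tendsto_eq_intros)
    have "(\<lambda>n. qdist V (s n) (t n)) \<longlonglongrightarrow> 0"
      by (rule tendsto_0_le_real[OF lim qdist_V_nonneg[OF sV] le])
    then show "(s, t) \<in> qequiv V"
      using seqs_to_qCauchy[OF z(1) s] seqs_to_qCauchy[OF z(2) t] by (simp add: qequiv_def)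
  qed
qed

text \<open>Completeness of \<open>W\<close> provides a limit for every sequence in the class, and
  equivalence forces that limit to be \<open>z\<close>; hence the class depends on \<open>z\<close>
  alone.\<close>

lemma qequiv_class:
  assumes z: "z \<in> qcarrier W" and s: "s \<in> seqs_to z"
  shows "qequiv V `` {s} = seqs_to z"
proof (intro set_eqI iffI)
  fix t assume "t \<in> qequiv V `` {s}"
  then have st: "(s, t) \<in> qequiv V" by simp
  then have "t \<in> qCauchy V" by (simp add: qequiv_def)
  then obtain z' where "z' \<in> qcarrier W" "t \<in> seqs_to z'" by (rule qCauchy_seqs_to)
  then show "t \<in> seqs_to z" using qequiv_iff_same_limit[OF z _ s] st by blast
next
  fix t assume "t \<in> seqs_to z"
  then show "t \<in> qequiv V `` {s}" using qequiv_iff_same_limit[OF z z s] by simp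
qed

lemma seqs_to_nonempty: "z \<in> qcarrier W \<Longrightarrow> seqs_to z \<noteq> {}"
  using dense unfolding seqs_to_def by blast

lemma quotient_eq: "qCauchy V // qequiv V = seqs_to ` qcarrier W"
proof (intro set_eqI iffI)
  fix P assume "P \<in> qCauchy V // qequiv V"
  then obtain s where s: "s \<in> qCauchy V" "P = qequiv V `` {s}" by (auto elim: quotientE)
  from s(1) obtain z where z: "z \<in> qcarrier W" "s \<in> seqs_to z" by (rule qCauchy_seqs_to)
  then show "P \<in> seqs_to ` qcarrier W" using qequiv_class s(2) by simp
next
  fix P assume "P \<in> seqs_to ` qcarrier W"
  then obtain z where z: "z \<in> qcarrier W" "P = seqs_to z" by blast
  obtain s where s: "s \<in> seqs_to z" using seqs_to_nonempty z(1) by blast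
  then show "P \<in> qCauchy V // qequiv V"
    using quotientI[OF seqs_to_qCauchy[OF z(1) s], of "qequiv V"] qequiv_class[OF z(1) s] z(2) by simp
qed

lemma inj_on_seqs_to: "inj_on seqs_to (qcarrier W)"
proof (rule inj_onI)
  fix z z' assume z: "z \<in> qcarrier W" "z' \<in> qcarrier W" and eq: "seqs_to z = seqs_to z'"
  obtain s where s: "s \<in> seqs_to z" using seqs_to_nonempty z(1) by blast
  then have "(s, s) \<in> qequiv V" using qequiv_iff_same_limit[OF z(1) z(1)] by blast
  then show "z = z'" using qequiv_iff_same_limit[OF z s] s eq by blast
qed

section \<open>Operations and quasi-norm of the completion\<close>

lemma seqs_to_add:
  assumes z: "z \<in> qcarrier W" "z' \<in> qcarrier W" and s: "s \<in> seqs_to z" and t: "t \<in> seqs_to z'"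
  shows "(\<lambda>n. qadd V (s n) (t n)) \<in> seqs_to (qadd W z z')"
proof -
  have sV: "s n \<in> qcarrier V" "t n \<in> qcarrier V" for n using s t by (auto simp: seqs_to_def)
  have sW: "J (s n) \<in> qcarrier W" "J (t n) \<in> qcarrier W" for n using sV J_carrier by auto
  have lim: "(\<lambda>n. K * (qdist W (J (s n)) z + qdist W (J (t n)) z')) \<longlonglongrightarrow> 0"
    using s t by (auto simp: seqs_to_def intro!: tendsto_eq_intros)
  have "(\<lambda>n. qdist W (J (qadd V (s n) (t n))) (qadd W z z')) \<longlonglongrightarrow> 0"
  proof (rule tendsto_0_le_real[OF lim])
    fix n
    show "0 \<le> qdist W (J (qadd V (s n) (t n))) (qadd W z z')"
      using sV sW z by (intro qdist_nonneg J_carrier add_closed' add_closed)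
    show "qdist W (J (qadd V (s n) (t n))) (qadd W z z')
        \<le> K * (qdist W (J (s n)) z + qdist W (J (t n)) z')"
      using qdist_add sW z by (simp add: J_add sV)
  qed
  then show ?thesis using sV add_closed' by (simp add: seqs_to_def)
qed

lemma seqs_to_scale:
  assumes z: "z \<in> qcarrier W" and s: "s \<in> seqs_to z"
  shows "(\<lambda>n. qscale V c (s n)) \<in> seqs_to (qscale W c z)"
proof -
  have sV: "s n \<in> qcarrier V" for n using s by (auto simp: seqs_to_def)
  have "(\<lambda>n. cmod c * qdist W (J (s n)) z) \<longlonglongrightarrow> cmod c * 0"
    using s by (intro tendsto_intros) (auto simp: seqs_to_def)
  then show ?thesis
    using sV z J_carrier by (simp add: seqs_to_def scale_closed' J_scale qdist_scale)
qed

text \<open>The sum of two classes is defined as a union over representatives. All members of that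
  union coincide, and since representatives exist it collapses to one class.\<close>

lemma completion_add:
  assumes "z \<in> qcarrier W" "z' \<in> qcarrier W"
  shows "qadd (qcompletion V) (seqs_to z) (seqs_to z') = seqs_to (qadd W z z')"
proof -
  have "qequiv V `` {\<lambda>n. qadd V (s n) (t n)} = seqs_to (qadd W z z')"
    if "s \<in> seqs_to z" "t \<in> seqs_to z'" for s t
    using that assms by (intro qequiv_class add_closed seqs_to_add)
  then have "qadd (qcompletion V) (seqs_to z) (seqs_to z')
      = (\<Union>s\<in>seqs_to z. \<Union>t\<in>seqs_to z'. seqs_to (qadd W z z'))"
    unfolding qcompletion_def qnspace.simps by (intro SUP_cong refl)
  also have "\<dots> = seqs_to (qadd W z z')"
    using seqs_to_nonempty[OF assms(1)] seqs_to_nonempty[OF assms(2)] by simp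
  finally show ?thesis .
qed

lemma completion_scale:
  assumes "z \<in> qcarrier W"
  shows "qscale (qcompletion V) c (seqs_to z) = seqs_to (qscale W c z)"
proof -
  have "qequiv V `` {\<lambda>n. qscale V c (s n)} = seqs_to (qscale W c z)" if "s \<in> seqs_to z" for s
    using that assms by (intro qequiv_class scale_closed seqs_to_scale)
  then have "qscale (qcompletion V) c (seqs_to z) = (\<Union>s\<in>seqs_to z. seqs_to (qscale W c z))"
    unfolding qcompletion_def qnspace.simps by (intro SUP_cong refl)
  also have "\<dots> = seqs_to (qscale W c z)" using seqs_to_nonempty[OF assms] by simp
  finally show ?thesis .
qed

text \<open>An eventual bound \<open>C\<close> along a representative gives
  \<open>qnorm W z \<le> K * (M * C)\<close> in the limit, while every representative is eventually
  bounded by \<open>K / m * (qnorm W z + e)\<close>. The factor \<open>K\<close> appears because the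
  quasi-norm may jump in the limit.\<close>

lemma completion_norm:
  assumes z: "z \<in> qcarrier W"
  shows "m / K * qnorm (qcompletion V) (seqs_to z) \<le> qnorm W z"
    and "qnorm W z \<le> K * M * qnorm (qcompletion V) (seqs_to z)"
proof -
  define X where "X = {C. \<exists>s\<in>seqs_to z. \<forall>\<^sub>F n in sequentially. qnorm V (s n) \<le> C}"
  have norm_eq: "qnorm (qcompletion V) (seqs_to z) = Inf X" by (simp add: qcompletion_def X_def)
  have K: "K > 0" using K_ge_1 by simp
  have lower: "qnorm W z / (K * M) \<le> C" if C_in: "C \<in> X" for C
  proof -
    obtain s where s: "s \<in> seqs_to z" and C: "\<forall>\<^sub>F n in sequentially. qnorm V (s n) \<le> C"
      using C_in unfolding X_def by blast
    have sV: "s n \<in> qcarrier V" for n using s by (auto simp: seqs_to_def)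
    have lim: "(\<lambda>n. K * (M * C + qdist W (J (s n)) z)) \<longlonglongrightarrow> K * (M * C + 0)"
      using s by (intro tendsto_intros) (auto simp: seqs_to_def)
    have "\<forall>\<^sub>F n in sequentially. qnorm W z \<le> K * (M * C + qdist W (J (s n)) z)"
      using C
    proof eventually_elim
      case (elim n)
      have "qnorm W z \<le> K * (qnorm W (J (s n)) + qdist W z (J (s n)))"
        using z sV J_carrier by (intro qnorm_le) auto
      also have "\<dots> \<le> K * (M * qnorm V (s n) + qdist W z (J (s n)))"
        using K J_upper[OF sV] by (intro mult_left_mono add_right_mono) auto
      also have "\<dots> \<le> K * (M * C + qdist W z (J (s n)))"
        using K M_pos elim by (intro mult_left_mono add_right_mono) auto
      finally show ?case using qdist_commute[OF z J_carrier[OF sV]] by simp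
    qed
    then have "qnorm W z \<le> K * (M * C + 0)"
      by (intro tendsto_lowerbound[OF lim]) auto
    then show ?thesis using K M_pos by (simp add: field_simps)
  qed
  have upper: "K / m * (qnorm W z + e) \<in> X" if e: "e > 0" for e
  proof -
    obtain s where s: "s \<in> seqs_to z" using seqs_to_nonempty z by blast
    have sV: "s n \<in> qcarrier V" for n using s by (auto simp: seqs_to_def)
    have "(\<lambda>n. qdist W (J (s n)) z) \<longlonglongrightarrow> 0" using s by (simp add: seqs_to_def)
    from order_tendstoD(2)[OF this e]
    have "\<forall>\<^sub>F n in sequentially. qnorm V (s n) \<le> K / m * (qnorm W z + e)"
    proof eventually_elim
      case (elim n)
      have "m * qnorm V (s n) \<le> qnorm W (J (s n))" using J_lower sV by blast
      also have "\<dots> \<le> K * (qnorm W z + qdist W (J (s n)) z)"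
        using z sV J_carrier by (intro qnorm_le) auto
      also have "\<dots> \<le> K * (qnorm W z + e)" using K elim by (intro mult_left_mono) auto
      finally show ?case using m_pos by (simp add: field_simps)
    qed
    then show ?thesis using s by (auto simp: X_def)
  qed
  have bdd: "bdd_below X" using lower by (intro bdd_belowI) auto
  have "X \<noteq> {}" using upper[of 1] by auto
  then have "qnorm W z / (K * M) \<le> Inf X" using lower by (intro cInf_greatest) auto
  then show "qnorm W z \<le> K * M * qnorm (qcompletion V) (seqs_to z)"
    using K M_pos by (simp add: norm_eq field_simps)
  have "m / K * Inf X \<le> qnorm W z + e" if e_pos: "e > 0" for e
  proof -
    have "Inf X \<le> K / m * (qnorm W z + e)" using upper[OF e_pos] bdd by (rule cInf_lower)
    then show ?thesis using K m_pos by (simp add: field_simps)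
  qed
  then show "m / K * qnorm (qcompletion V) (seqs_to z) \<le> qnorm W z"
    unfolding norm_eq by (rule field_le_epsilon)
qed

text \<open>The isomorphism sends a class to the common limit in \<open>W\<close> of the
  \<open>J\<close>-images of its members.\<close>

theorem qcompletion_isomorphic: "qn_isomorphic (qcompletion V) W"
proof -
  define T where "T = the_inv_into (qcarrier W) seqs_to"
  have carrier: "qcarrier (qcompletion V) = seqs_to ` qcarrier W"
    by (simp add: qcompletion_def quotient_eq)
  have T: "T (seqs_to z) = z" if "z \<in> qcarrier W" for z
    using that inj_on_seqs_to by (simp add: T_def the_inv_into_f_f)
  have K: "K > 0" using K_ge_1 by simp
  have bij: "bij_betw T (qcarrier (qcompletion V)) (qcarrier W)"
    unfolding carrier T_def
    by (intro bij_betw_the_inv_into) (simp add: bij_betw_def inj_on_seqs_to)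
  have add: "T (qadd (qcompletion V) P Q) = qadd W (T P) (T Q)"
    if "P \<in> qcarrier (qcompletion V)" "Q \<in> qcarrier (qcompletion V)" for P Q
    using that by (auto simp: carrier completion_add T add_closed)
  have scale: "T (qscale (qcompletion V) c P) = qscale W c (T P)"
    if "P \<in> qcarrier (qcompletion V)" for c P
    using that by (auto simp: carrier completion_scale T scale_closed)
  have "m / K * qnorm (qcompletion V) P \<le> qnorm W (T P)"
    and "qnorm W (T P) \<le> K * M * qnorm (qcompletion V) P"
    if "P \<in> qcarrier (qcompletion V)" for P
    using that completion_norm by (auto simp: carrier T)
  moreover have "0 < m / K" "0 < K * M" using K m_pos M_pos by auto
  ultimately show ?thesis
    unfolding qn_isomorphic_def using bij add scale by blast
qed

end

section \<open>The space of square-summable sequences and the Kalton-Peck map\<close>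

text \<open>Bounds on all initial segments give membership and the norm bound together, so
  inequalities for \<open>ell2_norm\<close> reduce to those for \<open>L2_set\<close>.\<close>

lemma ell2I:
  assumes "\<And>n. L2_set (\<lambda>i. cmod (x i)) {..<n} \<le> C"
  shows "x \<in> ell2" "ell2_norm x \<le> C"
proof -
  have C: "0 \<le> C" using assms[of 0] by simp
  have le: "(\<Sum>i<n. (cmod (x i))\<^sup>2) \<le> C\<^sup>2" for n
    using assms[of n] C by (simp add: L2_set_def real_sqrt_le_iff' real_le_lsqrt sqrt_le_D)
  have s: "summable (\<lambda>i. (cmod (x i))\<^sup>2)" by (rule summableI_nonneg_bounded[OF _ le]) simp
  then show "x \<in> ell2" by (simp add: ell2_def)
  have "(\<Sum>i. (cmod (x i))\<^sup>2) \<le> C\<^sup>2" by (rule suminf_le_const[OF s le])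
  then show "ell2_norm x \<le> C" using C by (simp add: ell2_norm_def real_le_lsqrt)
qed

lemma L2_set_le_ell2_norm:
  assumes "x \<in> ell2" "finite F" shows "L2_set (\<lambda>i. cmod (x i)) F \<le> ell2_norm x"
  using assms unfolding L2_set_def ell2_norm_def ell2_def
  by (auto intro!: sum_le_suminf)

lemma ell2_norm_nonneg: "x \<in> ell2 \<Longrightarrow> 0 \<le> ell2_norm x"
  using L2_set_le_ell2_norm[of x "{}"] by simp

lemma cmod_le_ell2_norm: "x \<in> ell2 \<Longrightarrow> cmod (x i) \<le> ell2_norm x"
  using L2_set_le_ell2_norm[of x "{i}"] by (simp add: L2_set_def)

lemma ell2_norm_eq_0D: "x \<in> ell2 \<Longrightarrow> ell2_norm x = 0 \<Longrightarrow> x = (\<lambda>_. 0)"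
  using cmod_le_ell2_norm by fastforce

text \<open>Minkowski's inequality on initial segments. Stated with pointwise domination, it covers
  sums, differences, the reverse triangle inequality and the defect of \<open>kp\<close>.\<close>

lemma ell2_add_bound:
  assumes x: "x \<in> ell2" and y: "y \<in> ell2" and le: "\<And>i. cmod (z i) \<le> cmod (x i) + cmod (y i)"
  shows "z \<in> ell2" "ell2_norm z \<le> ell2_norm x + ell2_norm y"
proof -
  have "L2_set (\<lambda>i. cmod (z i)) {..<n} \<le> ell2_norm x + ell2_norm y" for n
  proof -
    have "L2_set (\<lambda>i. cmod (z i)) {..<n} \<le> L2_set (\<lambda>i. cmod (x i) + cmod (y i)) {..<n}"
      using le by (intro L2_set_mono) auto
    also have "\<dots> \<le> L2_set (\<lambda>i. cmod (x i)) {..<n} + L2_set (\<lambda>i. cmod (y i)) {..<n}"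
      by (rule L2_set_triangle_ineq)
    also have "\<dots> \<le> ell2_norm x + ell2_norm y"
      using x y by (intro add_mono L2_set_le_ell2_norm) auto
    finally show ?thesis .
  qed
  then show "z \<in> ell2" "ell2_norm z \<le> ell2_norm x + ell2_norm y" by (rule ell2I)+
qed

lemma ell2_add:
  assumes "x \<in> ell2" "y \<in> ell2"
  shows "(\<lambda>i. x i + y i) \<in> ell2" "ell2_norm (\<lambda>i. x i + y i) \<le> ell2_norm x + ell2_norm y"
  by (rule ell2_add_bound[OF assms], rule norm_triangle_ineq)+

lemma ell2_diff:
  assumes "x \<in> ell2" "y \<in> ell2"
  shows "(\<lambda>i. x i - y i) \<in> ell2" "ell2_norm (\<lambda>i. x i - y i) \<le> ell2_norm x + ell2_norm y"
  by (rule ell2_add_bound[OF assms], rule norm_triangle_ineq4)+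

lemma ell2_scale:
  assumes "x \<in> ell2"
  shows "(\<lambda>i. c * x i) \<in> ell2" "ell2_norm (\<lambda>i. c * x i) = cmod c * ell2_norm x"
  using assms
  by (simp_all add: ell2_def ell2_norm_def norm_mult power_mult_distrib suminf_mult real_sqrt_mult)

lemma ell2_norm_cmod: "ell2_norm (\<lambda>i. complex_of_real (cmod (x i))) = ell2_norm x"
  by (simp add: ell2_norm_def)

lemma ell2_cmod: "x \<in> ell2 \<Longrightarrow> (\<lambda>i. complex_of_real (cmod (x i))) \<in> ell2"
  by (simp add: ell2_def)

lemma ell2_norm_minus_commute: "ell2_norm (\<lambda>i. x i - y i) = ell2_norm (\<lambda>i. y i - x i)"
  by (simp add: ell2_norm_def norm_minus_commute)

lemma ell2_norm_zero: "ell2_norm (\<lambda>_. 0) = 0"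
  by (simp add: ell2_norm_def)

lemma ell2_norm_diff_ge:
  assumes "x \<in> ell2" "y \<in> ell2"
  shows "\<bar>ell2_norm x - ell2_norm y\<bar> \<le> ell2_norm (\<lambda>i. x i - y i)"
proof -
  note d = ell2_diff(1)[OF assms]
  have "ell2_norm x \<le> ell2_norm (\<lambda>i. x i - y i) + ell2_norm y"
    by (rule ell2_add_bound(2)[OF d assms(2)]) (metis diff_add_cancel norm_triangle_ineq)
  moreover have "ell2_norm y \<le> ell2_norm x + ell2_norm (\<lambda>i. x i - y i)"
    by (rule ell2_add_bound(2)[OF assms(1) d]) (metis norm_triangle_sub norm_minus_commute)
  ultimately show ?thesis by simp
qed

text \<open>Each finite section of the norm passes to a coordinatewise limit, and the sections
  determine the norm. This is the source of completeness below.\<close>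

lemma ell2_fatou:
  assumes lim: "\<And>i. (\<lambda>n. X n i) \<longlonglongrightarrow> x i"
    and bound: "\<forall>\<^sub>F n in sequentially. X n \<in> ell2 \<and> ell2_norm (X n) \<le> C"
  shows "x \<in> ell2" "ell2_norm x \<le> C"
proof -
  have "L2_set (\<lambda>i. cmod (x i)) {..<k} \<le> C" for k
  proof (rule tendsto_upperbound)
    show "(\<lambda>n. L2_set (\<lambda>i. cmod (X n i)) {..<k}) \<longlonglongrightarrow> L2_set (\<lambda>i. cmod (x i)) {..<k}"
      unfolding L2_set_def by (intro tendsto_intros lim)
    show "\<forall>\<^sub>F n in sequentially. L2_set (\<lambda>i. cmod (X n i)) {..<k} \<le> C"
      using bound by eventually_elim (metis L2_set_le_ell2_norm finite_lessThan order_trans)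
  qed simp
  then show "x \<in> ell2" "ell2_norm x \<le> C" by (rule ell2I)+
qed

lemma ell2_finite_supp:
  assumes "finite F" "supp x \<subseteq> F"
  shows "x \<in> ell2" "ell2_norm x = L2_set (\<lambda>i. cmod (x i)) F"
proof -
  have 0: "(cmod (x i))\<^sup>2 = 0" if "i \<notin> F" for i using assms that by (auto simp: supp_def)
  show "x \<in> ell2" unfolding ell2_def using summable_finite[OF assms(1) 0] by simp
  show "ell2_norm x = L2_set (\<lambda>i. cmod (x i)) F"
    unfolding ell2_norm_def L2_set_def using suminf_finite[OF assms(1) 0] by simp
qed

lemma c00_ell2: "x \<in> c00 \<Longrightarrow> x \<in> ell2"
  by (auto simp: c00_def intro: ell2_finite_supp)

lemma c00_add: "x \<in> c00 \<Longrightarrow> y \<in> c00 \<Longrightarrow> (\<lambda>i. x i + y i) \<in> c00"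
  unfolding c00_def supp_def mem_Collect_eq
  by (rule finite_subset[of _ "{i. x i \<noteq> 0} \<union> {i. y i \<noteq> 0}"]) auto

lemma c00_scale: "x \<in> c00 \<Longrightarrow> (\<lambda>i. c * x i) \<in> c00"
  unfolding c00_def supp_def mem_Collect_eq by (rule finite_subset[of _ "{i. x i \<noteq> 0}"]) auto

lemma restr_c00: "finite A \<Longrightarrow> restr A x \<in> c00"
  unfolding c00_def supp_def restr_def by (auto intro: finite_subset[of _ A])

text \<open>The squared norm of the tail is the full series minus its partial sum.\<close>

lemma ell2_tail:
  assumes x: "x \<in> ell2"
  shows "(\<lambda>i. x i - restr {..<n} x i) \<in> ell2"
    and "(\<lambda>n. ell2_norm (\<lambda>i. x i - restr {..<n} x i)) \<longlonglongrightarrow> 0"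
proof -
  define T where "T = (\<lambda>n i. x i - restr {..<n} x i)"
  have s: "summable (\<lambda>i. (cmod (x i))\<^sup>2)" using x by (simp add: ell2_def)
  have "(\<lambda>i. (cmod (x i))\<^sup>2 - (if i \<in> {..<n} then (cmod (x i))\<^sup>2 else 0))
      sums ((\<Sum>i. (cmod (x i))\<^sup>2) - (\<Sum>i<n. (cmod (x i))\<^sup>2))" for n
    by (intro sums_diff summable_sums s sums_If_finite_set) simp
  also have "(\<lambda>i. (cmod (x i))\<^sup>2 - (if i \<in> {..<n} then (cmod (x i))\<^sup>2 else 0))
      = (\<lambda>i. (cmod (T n i))\<^sup>2)" for n by (auto simp: T_def restr_def)
  finally have sums: "(\<lambda>i. (cmod (T n i))\<^sup>2) sums ((\<Sum>i. (cmod (x i))\<^sup>2) - (\<Sum>i<n. (cmod (x i))\<^sup>2))"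
    for n .
  then show "(\<lambda>i. x i - restr {..<n} x i) \<in> ell2" for n
    by (auto simp: ell2_def T_def sums_iff)
  have "(\<lambda>n. (\<Sum>i. (cmod (x i))\<^sup>2) - (\<Sum>i<n. (cmod (x i))\<^sup>2)) \<longlonglongrightarrow> 0"
    using tendsto_diff[OF tendsto_const summable_LIMSEQ[OF s], of "\<Sum>i. (cmod (x i))\<^sup>2"] by simp
  then have "(\<lambda>n. sqrt ((\<Sum>i. (cmod (x i))\<^sup>2) - (\<Sum>i<n. (cmod (x i))\<^sup>2))) \<longlonglongrightarrow> 0"
    using tendsto_real_sqrt by fastforce
  also have "(\<lambda>n. sqrt ((\<Sum>i. (cmod (x i))\<^sup>2) - (\<Sum>i<n. (cmod (x i))\<^sup>2))) = (\<lambda>n. ell2_norm (T n))"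
    using sums by (auto simp: ell2_norm_def sums_iff)
  finally show "(\<lambda>n. ell2_norm (\<lambda>i. x i - restr {..<n} x i)) \<longlonglongrightarrow> 0" by (simp add: T_def)
qed

section \<open>Estimates for the Kalton-Peck map: boundedness, quasi-linearity, continuity\<close>

lemma abs_mult_ln_le:
  fixes t s :: real
  assumes "0 \<le> t" "t \<le> s" shows "\<bar>t * ln (t / s)\<bar> \<le> s"
proof (cases "t = 0")
  case False
  then have t: "0 < t" "0 < s" using assms by auto
  \<comment> \<open>Multiplied by \<open>t\<close>, this gives
    \<open>t * ln (s / t) \<le> s - t\<close>.\<close>
  have "ln (s / t) \<le> s / t - 1" using t by (intro ln_le_minus_one) simp
  then have "t * ln (s / t) \<le> t * (s / t - 1)" using t by (intro mult_left_mono) auto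
  also have "\<dots> \<le> s" using t by (simp add: field_simps)
  finally have "t * ln (s / t) \<le> s" .
  moreover have "0 \<le> t * ln (s / t)" using t assms by (intro mult_nonneg_nonneg) auto
  moreover have "ln (t / s) = - ln (s / t)" using t by (simp add: ln_div)
  ultimately show ?thesis by simp
qed (use assms in simp)

lemma kp_eq:
  assumes "y \<in> ell2"
  shows "kp y i = y i * complex_of_real (ln (cmod (y i) / ell2_norm y))"
  using ell2_norm_nonneg[OF assms] by (simp add: kp_def kp_unit_def norm_divide)

lemma kp_scale:
  assumes "y \<in> ell2" shows "kp (\<lambda>i. c * y i) = (\<lambda>i. c * kp y i)"
proof (cases "c = 0")
  case True
  then show ?thesis by (simp add: kp_def kp_unit_def)
next
  case False
  then show ?thesis using ell2_scale[OF assms, of c]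
    by (auto simp: kp_eq assms norm_mult)
qed

text \<open>Although \<open>kp y\<close> need not lie in \<open>ell2\<close>, its coordinates are
  controlled by the norm of \<open>y\<close>: take \<open>t = cmod (y i)\<close> and
  \<open>s = ell2_norm y\<close> in \<open>abs_mult_ln_le\<close>.\<close>

lemma cmod_kp_le: "y \<in> ell2 \<Longrightarrow> cmod (kp y i) \<le> ell2_norm y"
  using abs_mult_ln_le[of "cmod (y i)" "ell2_norm y"] cmod_le_ell2_norm[of y i]
  by (simp add: kp_eq norm_mult abs_mult)

text \<open>Splits the logarithm along the chain \<open>cmod (y i)\<close>, \<open>s\<close>,
  \<open>S\<close>, \<open>ell2_norm y\<close>. Positivity is asked only where \<open>y i\<close> is
  nonzero, since all terms vanish elsewhere.\<close>

lemma kp_rescale: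
  assumes y: "y \<in> ell2" and s: "y i \<noteq> 0 \<Longrightarrow> 0 < s" "y i \<noteq> 0 \<Longrightarrow> 0 < S"
  shows "kp y i = y i * ln (cmod (y i) / s) + y i * ln (s / S) + y i * ln (S / ell2_norm y)"
proof (cases "y i = 0")
  case False
  then have "0 < cmod (y i)" by simp
  also have "\<dots> \<le> ell2_norm y" by (rule cmod_le_ell2_norm[OF y])
  finally have "ln (cmod (y i) / ell2_norm y) = ln (cmod (y i) / s) + ln (s / S) + ln (S / ell2_norm y)"
    using s False by (simp add: ln_div)
  then show ?thesis by (simp add: kp_eq[OF y] algebra_simps)
qed (simp add: kp_eq[OF y])

text \<open>Rescaling the logarithms by \<open>|x\<^sub>i| + |y\<^sub>i|\<close> and by \<open>S\<close> leaves only terms of the form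
  \<open>t ln (t / s)\<close> with \<open>t \<le> s\<close>.\<close>

lemma kp_quasi_linear:
  assumes x: "x \<in> ell2" and y: "y \<in> ell2"
  defines "E \<equiv> \<lambda>i. kp (\<lambda>i. x i + y i) i - kp x i - kp y i"
  shows "E \<in> ell2" "ell2_norm E \<le> 6 * (ell2_norm x + ell2_norm y)"
proof -
  define S where "S = ell2_norm x + ell2_norm y"
  define z where "z = (\<lambda>i. x i + y i)"
  \<comment> \<open>Coefficient that remains after rescaling by \<open>S\<close>. Up to sign, the
    product of \<open>ln (S / ell2_norm u)\<close> and \<open>ell2_norm u\<close> has the form t ln
    (t / S) with t \<le> S, so \<open>c u * ell2_norm u\<close> is at most \<open>S\<close>.\<close>
  define c where "c = (\<lambda>u. \<bar>ln (S / ell2_norm u)\<bar>)"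
  have z: "z \<in> ell2" and zS: "ell2_norm z \<le> S"
    unfolding z_def S_def using ell2_add[OF x y] by auto
  have nn: "0 \<le> ell2_norm x" "0 \<le> ell2_norm y" "0 \<le> ell2_norm z"
    using x y z by (auto intro: ell2_norm_nonneg)
  have c0: "0 \<le> c u" for u by (simp add: c_def)
  have c_le: "c u * ell2_norm u \<le> S" if "0 \<le> ell2_norm u" "ell2_norm u \<le> S" for u
  proof (cases "ell2_norm u = 0")
    case False
    then have "ln (S / ell2_norm u) = - ln (ell2_norm u / S)" using that by (simp add: ln_div)
    then show ?thesis using abs_mult_ln_le[OF that] that by (simp add: c_def abs_mult mult.commute)
  qed (use that in simp)
  have bound: "cmod (E i) \<le> 3 * (cmod (x i) + cmod (y i)) + c z * cmod (z i) + c x * cmod (x i) + c y * cmod (y i)"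
    for i
  proof -
    define s where "s = cmod (x i) + cmod (y i)"
    have zs: "cmod (z i) \<le> s" unfolding z_def s_def by (rule norm_triangle_ineq)
    have pos: "0 < s" "0 < S" if "x i \<noteq> 0 \<or> y i \<noteq> 0 \<or> z i \<noteq> 0"
    proof -
      show "0 < s" using that zs by (auto simp: s_def add_pos_nonneg add_nonneg_pos z_def)
      also have "s \<le> S" unfolding s_def S_def by (intro add_mono cmod_le_ell2_norm x y)
      finally show "0 < S" .
    qed
    define g where "g = (\<lambda>u::complex. u * ln (cmod u / s))"
    have g: "cmod (g u) \<le> s" if "cmod u \<le> s" for u
      using abs_mult_ln_le[OF _ that] by (simp add: g_def norm_mult abs_mult)
    have kp: "kp x i = g (x i) + x i * ln (s / S) + x i * ln (S / ell2_norm x)"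
      "kp y i = g (y i) + y i * ln (s / S) + y i * ln (S / ell2_norm y)"
      "kp z i = g (z i) + z i * ln (s / S) + z i * ln (S / ell2_norm z)"
      unfolding g_def using pos x y z by (intro kp_rescale; simp)+
    have "E i = kp z i - kp x i - kp y i" by (simp add: E_def z_def)
    \<comment> \<open>The terms with \<open>ln (s / S)\<close> have cancelled because
      \<open>z i = x i + y i\<close>.\<close>
    also have "\<dots> = g (z i) - g (x i) - g (y i) + z i * ln (S / ell2_norm z)
        - x i * ln (S / ell2_norm x) - y i * ln (S / ell2_norm y)"
      unfolding kp by (simp add: z_def algebra_simps)
    also have "cmod \<dots> \<le> cmod (g (z i)) + cmod (g (x i)) + cmod (g (y i)) + cmod (z i * ln (S / ell2_norm z))
        + cmod (x i * ln (S / ell2_norm x)) + cmod (y i * ln (S / ell2_norm y))"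
      by (intro order_trans[OF norm_triangle_ineq4] order_trans[OF norm_triangle_ineq] add_mono order_refl)
    also have "\<dots> \<le> s + s + s + c z * cmod (z i) + c x * cmod (x i) + c y * cmod (y i)"
      by (intro add_mono g zs) (auto simp: s_def norm_mult c_def mult.commute)
    finally show ?thesis by (simp add: s_def)
  qed
  define h where "h = (\<lambda>(u::cseq) (k::real) i. complex_of_real k * complex_of_real (cmod (u i)))"
  have h: "h u k \<in> ell2" "ell2_norm (h u k) = k * ell2_norm u" "cmod (h u k i) = k * cmod (u i)"
    if "u \<in> ell2" "0 \<le> k" for u k i
    unfolding h_def using ell2_scale[OF ell2_cmod[OF that(1)], of k] that
    by (simp_all add: ell2_norm_cmod norm_mult)
  define hx where "hx = h x (3 + c x)"
  define hy where "hy = h y (3 + c y)"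
  have hx: "hx \<in> ell2" "ell2_norm hx = (3 + c x) * ell2_norm x" "\<And>i. cmod (hx i) = (3 + c x) * cmod (x i)"
    unfolding hx_def using h x c0 by (simp_all add: add_nonneg_nonneg)
  have hy: "hy \<in> ell2" "ell2_norm hy = (3 + c y) * ell2_norm y" "\<And>i. cmod (hy i) = (3 + c y) * cmod (y i)"
    unfolding hy_def using h y c0 by (simp_all add: add_nonneg_nonneg)
  \<comment> \<open>Three sequences dominate \<open>E\<close>, while \<open>ell2_add_bound\<close>
    takes two; so \<open>hx\<close> and \<open>hy\<close> are joined first.\<close>
  define G where "G = (\<lambda>i. complex_of_real (cmod (hx i) + cmod (hy i)))"
  have Gi: "cmod (G i) = cmod (hx i) + cmod (hy i)" for i
    unfolding G_def by (simp only: norm_of_real) simp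
  then have G: "G \<in> ell2" "ell2_norm G \<le> ell2_norm hx + ell2_norm hy"
    using ell2_add_bound[OF hx(1) hy(1), of G] by simp_all
  have E_le: "cmod (E i) \<le> cmod (G i) + cmod (h z (c z) i)" for i
    using bound[of i] unfolding Gi hx hy h(3)[OF z c0] by (simp add: algebra_simps)
  note E = ell2_add_bound[OF G(1) h(1)[OF z c0] E_le]
  show "E \<in> ell2" by (rule E)
  have "ell2_norm E \<le> (3 + c x) * ell2_norm x + (3 + c y) * ell2_norm y + c z * ell2_norm z"
    using E(2) G(2) h(2)[OF z c0] hx hy by simp
  also have "\<dots> = 3 * S + c x * ell2_norm x + c y * ell2_norm y + c z * ell2_norm z"
    by (simp add: S_def algebra_simps)
  \<comment> \<open>Three from the local terms \<open>g\<close> and one each from \<open>x\<close>,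
    \<open>y\<close> and \<open>z\<close> make up the constant 6.\<close>
  also have "\<dots> \<le> 3 * S + S + S + S"
    using nn zS by (intro add_mono c_le) (auto simp: S_def)
  finally show "ell2_norm E \<le> 6 * (ell2_norm x + ell2_norm y)" by (simp add: S_def)
qed

text \<open>Only the limit 0 is critical. For |u| < 1 and t = sqrt |u|, the modulus of u ln |u| is 2
  t |t ln t|, hence at most 2 t.\<close>

lemma tendsto_mult_ln_cmod:
  fixes w :: complex
  assumes "X \<longlonglongrightarrow> w"
  shows "(\<lambda>n. X n * complex_of_real (ln (cmod (X n)))) \<longlonglongrightarrow> w * complex_of_real (ln (cmod w))"
proof (cases "w = 0")
  case False
  then show ?thesis using assms by (intro tendsto_intros) auto
next
  case True
  have le: "norm (X n * complex_of_real (ln (cmod (X n)))) \<le> 2 * sqrt (cmod (X n))"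
    if "cmod (X n) < 1" for n
  proof (cases "X n = 0")
    case False
    define t where "t = sqrt (cmod (X n))"
    have t: "0 < t" "t < 1" "cmod (X n) = t * t" using False that by (auto simp: t_def)
    have "\<bar>t * ln (t / 1)\<bar> \<le> 1" using t by (intro abs_mult_ln_le) auto
    then have "2 * t * \<bar>t * ln t\<bar> \<le> 2 * t * 1" using t by (intro mult_left_mono) auto
    moreover have "norm (X n * complex_of_real (ln (cmod (X n)))) = 2 * t * \<bar>t * ln t\<bar>"
      using t by (simp add: norm_mult ln_mult abs_mult)
    ultimately show ?thesis by (simp add: t_def)
  qed simp
  have "(\<lambda>n. cmod (X n)) \<longlonglongrightarrow> 0" using assms True tendsto_norm_zero by blast
  from order_tendstoD(2)[OF this, of 1] have ev: "\<forall>\<^sub>F n in sequentially. cmod (X n) < 1" by simp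
  have "(\<lambda>n. 2 * sqrt (cmod (X n))) \<longlonglongrightarrow> 2 * sqrt (cmod w)"
    by (intro tendsto_intros assms)
  then have "(\<lambda>n. 2 * sqrt (cmod (X n))) \<longlonglongrightarrow> 0" using True by simp
  then have "(\<lambda>n. X n * complex_of_real (ln (cmod (X n)))) \<longlonglongrightarrow> 0"
    by (rule Lim_null_comparison[rotated]) (use ev le in \<open>auto elim: eventually_mono\<close>)
  then show ?thesis using True by simp
qed

text \<open>Norm convergence of the arguments controls the normalization inside the logarithm;
  coordinatewise convergence of the values is what \<open>ell2_fatou\<close> takes as input.\<close>

lemma kp_pointwise_continuous:
  assumes X: "\<And>n. X n \<in> ell2" and y: "y \<in> ell2" and lim: "(\<lambda>n. ell2_norm (\<lambda>i. X n i - y i)) \<longlonglongrightarrow> 0"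
  shows "(\<lambda>n. kp (X n) i) \<longlonglongrightarrow> kp y i"
proof -
  have nlim: "(\<lambda>n. ell2_norm (X n)) \<longlonglongrightarrow> ell2_norm y"
    by (rule LIM_zero_cancel, rule Lim_null_comparison[OF _ lim])
      (use ell2_norm_diff_ge[OF X y] in simp)
  show ?thesis
  proof (cases "ell2_norm y = 0")
    case True
    then have "kp y i = 0" by (simp add: kp_def)
    moreover have "(\<lambda>n. kp (X n) i) \<longlonglongrightarrow> 0"
      by (rule Lim_null_comparison[OF _ nlim[unfolded True]]) (use cmod_kp_le[OF X] in simp)
    ultimately show ?thesis by simp
  next
    case False
    then have pos: "0 < ell2_norm y" using ell2_norm_nonneg[OF y] by simp
    have Xi: "(\<lambda>n. X n i) \<longlonglongrightarrow> y i"
      by (rule LIM_zero_cancel, rule Lim_null_comparison[OF _ lim])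
        (use cmod_le_ell2_norm[OF ell2_diff(1)[OF X y]] in simp)
    \<comment> \<open>With the two logarithms separated, a vanishing coordinate \<open>y i\<close>
      causes no harm: u ln |u| extends continuously by 0, and the norms stay away from 0.\<close>
    define f where "f = (\<lambda>(u::complex) (\<nu>::real). u * complex_of_real (ln (cmod u)) - u * complex_of_real (ln \<nu>))"
    have kp: "kp u i = f (u i) (ell2_norm u)" if "u \<in> ell2" "0 < ell2_norm u" for u
      using that by (cases "u i = 0") (simp_all add: kp_eq f_def ln_div algebra_simps)
    have "(\<lambda>n. f (X n i) (ell2_norm (X n))) \<longlonglongrightarrow> f (y i) (ell2_norm y)"
      unfolding f_def using pos
      by (intro tendsto_diff tendsto_mult_ln_cmod tendsto_mult Xi tendsto_of_real tendsto_ln nlim) simp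
    moreover have "\<forall>\<^sub>F n in sequentially. f (X n i) (ell2_norm (X n)) = kp (X n) i"
      using order_tendstoD(1)[OF nlim pos] by eventually_elim (use kp X in simp)
    ultimately show ?thesis using kp[OF y pos] by (simp add: tendsto_cong)
  qed
qed

section \<open>The Kalton-Peck space\<close>

lemma kalton_peck_simps:
  "(x, y) \<in> qcarrier kalton_peck \<longleftrightarrow> y \<in> ell2 \<and> (\<lambda>j. x j - kp y j) \<in> ell2"
  "qadd kalton_peck (x, y) (x', y') = (\<lambda>j. x j + x' j, \<lambda>j. y j + y' j)"
  "qscale kalton_peck c (x, y) = (\<lambda>j. c * x j, \<lambda>j. c * y j)"
  "qnorm kalton_peck (x, y) = ell2_norm (\<lambda>j. x j - kp y j) + ell2_norm y"
  "qdist kalton_peck (x, y) (x', y') = qnorm kalton_peck (\<lambda>j. x j - x' j, \<lambda>j. y j - y' j)"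
  by (simp_all add: kalton_peck_def twisted_sum_def qdist_def)

text \<open>The defect of \<open>kp\<close> contributes 6 times the norms of the second components,
  and the norm of their sum contributes them once more, which makes 7.\<close>

lemma kalton_peck_add:
  assumes "p \<in> qcarrier kalton_peck" "r \<in> qcarrier kalton_peck"
  shows "qadd kalton_peck p r \<in> qcarrier kalton_peck"
    and "qnorm kalton_peck (qadd kalton_peck p r) \<le> 7 * (qnorm kalton_peck p + qnorm kalton_peck r)"
proof -
  obtain x y x' y' where p: "p = (x, y)" and r: "r = (x', y')" by (metis surj_pair)
  have y: "y \<in> ell2" "y' \<in> ell2" and d: "(\<lambda>j. x j - kp y j) \<in> ell2" "(\<lambda>j. x' j - kp y' j) \<in> ell2"
    using assms by (auto simp: p r kalton_peck_simps)
  define E where "E = (\<lambda>i. kp (\<lambda>i. y i + y' i) i - kp y i - kp y' i)"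
  have E: "E \<in> ell2" "ell2_norm E \<le> 6 * (ell2_norm y + ell2_norm y')"
    unfolding E_def by (rule kp_quasi_linear[OF y])+
  note sum = ell2_add[OF d]
  have eq: "(\<lambda>j. x j + x' j - kp (\<lambda>i. y i + y' i) j)
      = (\<lambda>j. ((x j - kp y j) + (x' j - kp y' j)) - E j)" by (simp add: E_def algebra_simps)
  show "qadd kalton_peck p r \<in> qcarrier kalton_peck"
    using ell2_diff(1)[OF sum(1) E(1)] ell2_add(1)[OF y]
    by (simp add: p r kalton_peck_simps eq)
  have "0 \<le> ell2_norm (\<lambda>j. x j - kp y j)" "0 \<le> ell2_norm (\<lambda>j. x' j - kp y' j)"
    using d by (auto intro: ell2_norm_nonneg)
  then show "qnorm kalton_peck (qadd kalton_peck p r) \<le> 7 * (qnorm kalton_peck p + qnorm kalton_peck r)"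
    using ell2_diff(2)[OF sum(1) E(1)] ell2_add(2)[OF y] sum(2) E(2)
    by (simp add: p r kalton_peck_simps eq)
qed

lemma kalton_peck_scale:
  assumes "p \<in> qcarrier kalton_peck"
  shows "qscale kalton_peck c p \<in> qcarrier kalton_peck"
    and "qnorm kalton_peck (qscale kalton_peck c p) = cmod c * qnorm kalton_peck p"
proof -
  obtain x y where p: "p = (x, y)" by (metis surj_pair)
  have y: "y \<in> ell2" and d: "(\<lambda>j. x j - kp y j) \<in> ell2"
    using assms by (auto simp: p kalton_peck_simps)
  have eq: "(\<lambda>j. c * x j - kp (\<lambda>j. c * y j) j) = (\<lambda>j. c * (x j - kp y j))"
    by (simp add: kp_scale[OF y] algebra_simps)
  show "qscale kalton_peck c p \<in> qcarrier kalton_peck"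
    "qnorm kalton_peck (qscale kalton_peck c p) = cmod c * qnorm kalton_peck p"
    using ell2_scale[OF y, of c] ell2_scale[OF d, of c]
    by (simp_all add: p kalton_peck_simps eq algebra_simps)
qed

text \<open>The coordinate bound comes from writing \<open>x\<close> as \<open>x - kp y\<close> plus
  \<open>kp y\<close>, both bounded coordinatewise. It makes coordinates of Cauchy sequences
  converge even though \<open>x\<close> need not lie in \<open>ell2\<close>.\<close>

lemma kalton_peck_norm:
  assumes "p \<in> qcarrier kalton_peck"
  shows "0 \<le> qnorm kalton_peck p"
    and "qnorm kalton_peck p = 0 \<Longrightarrow> p = (\<lambda>_. 0, \<lambda>_. 0)"
    and "cmod (fst p i) \<le> 2 * qnorm kalton_peck p"
    and "ell2_norm (snd p) \<le> qnorm kalton_peck p"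
proof -
  obtain x y where p: "p = (x, y)" by (metis surj_pair)
  have y: "y \<in> ell2" and d: "(\<lambda>j. x j - kp y j) \<in> ell2"
    using assms by (auto simp: p kalton_peck_simps)
  note nn = ell2_norm_nonneg[OF y] ell2_norm_nonneg[OF d]
  show "0 \<le> qnorm kalton_peck p" using nn by (simp add: p kalton_peck_simps)
  show snd: "ell2_norm (snd p) \<le> qnorm kalton_peck p" using nn by (simp add: p kalton_peck_simps)
  have le: "cmod (x i) \<le> 2 * qnorm kalton_peck p" for i
  proof -
    have "cmod (x i) \<le> cmod (x i - kp y i) + cmod (kp y i)"
      by (metis diff_add_cancel norm_triangle_ineq)
    then show ?thesis
      using cmod_le_ell2_norm[OF d, of i] cmod_kp_le[OF y, of i] nn by (simp add: p kalton_peck_simps)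
  qed
  then show "cmod (fst p i) \<le> 2 * qnorm kalton_peck p" by (simp add: p)
  assume 0: "qnorm kalton_peck p = 0"
  then have "x i = 0" for i using le[of i] by simp
  moreover have "y = (\<lambda>_. 0)" using ell2_norm_eq_0D[OF y] snd nn 0 by (simp add: p)
  ultimately show "p = (\<lambda>_. 0, \<lambda>_. 0)" by (auto simp: p)
qed

lemma kalton_peck_diff:
  assumes "p \<in> qcarrier kalton_peck" "r \<in> qcarrier kalton_peck"
  shows "(\<lambda>j. fst p j - fst r j, \<lambda>j. snd p j - snd r j) \<in> qcarrier kalton_peck"
  using kalton_peck_add(1)[OF assms(1) kalton_peck_scale(1)[OF assms(2), of "- 1"]]
  by (cases p; cases r) (simp add: kalton_peck_simps(2,3))

text \<open>Limits are taken coordinatewise, and Fatou's lemma turns them into limits in quasi-norm: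
  first for the second components, then for the differences with \<open>kp\<close>.\<close>

lemma kalton_peck_complete:
  assumes s: "s \<in> qCauchy kalton_peck"
  shows "\<exists>z\<in>qcarrier kalton_peck. (\<lambda>n. qdist kalton_peck (s n) z) \<longlonglongrightarrow> 0"
proof -
  define X where "X = (\<lambda>n. fst (s n))"
  define Y where "Y = (\<lambda>n. snd (s n))"
  have s_eq: "s n = (X n, Y n)" for n by (simp add: X_def Y_def)
  have sC: "s n \<in> qcarrier kalton_peck" for n using s by (auto simp: qCauchy_def)
  then have Y2: "Y n \<in> ell2" for n by (simp add: s_eq kalton_peck_simps)
  have dC: "(\<lambda>j. X m j - X n j, \<lambda>j. Y m j - Y n j) \<in> qcarrier kalton_peck" for m n
    using kalton_peck_diff[OF sC sC, of m n] by (simp add: s_eq)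
  define D where "D = (\<lambda>m n. qdist kalton_peck (s m) (s n))"
  have D_eq: "D m n = qnorm kalton_peck (\<lambda>j. X m j - X n j, \<lambda>j. Y m j - Y n j)" for m n
    by (simp add: D_def s_eq kalton_peck_simps(5))
  have cauchy: "\<exists>L. \<forall>m\<ge>L. \<forall>n\<ge>L. D m n < e" if "e > 0" for e
    using s that by (auto simp: qCauchy_def D_def)
  have Xc: "cmod (X m i - X n i) \<le> 2 * D m n" for m n i
    using kalton_peck_norm(3)[OF dC] by (simp add: D_eq)
  have Yc: "ell2_norm (\<lambda>i. Y m i - Y n i) \<le> D m n" for m n
    using kalton_peck_norm(4)[OF dC] by (simp add: D_eq)
  \<comment> \<open>The factor 2 makes \<open>conv\<close> applicable to both components.\<close>
  have Yc': "cmod (Y m i - Y n i) \<le> 2 * D m n" for m n i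
  proof -
    have "cmod (Y m i - Y n i) \<le> ell2_norm (\<lambda>i. Y m i - Y n i)"
      by (rule cmod_le_ell2_norm[OF ell2_diff(1)[OF Y2 Y2]])
    then show ?thesis using Yc[of m n] kalton_peck_norm(1)[OF dC, of m n] by (simp add: D_eq)
  qed
  have conv: "convergent (\<lambda>n. f n i)" if f: "\<And>m n. cmod (f m i - f n i) \<le> 2 * D m n" for f :: "nat \<Rightarrow> cseq" and i
  proof (rule Cauchy_convergent, rule CauchyI)
    fix e :: real assume "e > 0"
    then obtain L where "\<forall>m\<ge>L. \<forall>n\<ge>L. D m n < e / 2" using cauchy[of "e / 2"] by auto
    then show "\<exists>L. \<forall>m\<ge>L. \<forall>n\<ge>L. norm (f m i - f n i) < e"
      using f by (intro exI[of _ L]) (smt (verit) field_sum_of_halves)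
  qed
  define x where "x = (\<lambda>i. lim (\<lambda>n. X n i))"
  define y where "y = (\<lambda>i. lim (\<lambda>n. Y n i))"
  have Xlim: "(\<lambda>n. X n i) \<longlonglongrightarrow> x i" and Ylim: "(\<lambda>n. Y n i) \<longlonglongrightarrow> y i" for i
    using conv[of X i, OF Xc] conv[of Y i, OF Yc'] by (auto simp: x_def y_def convergent_LIMSEQ_iff)
  have tailY: "(\<lambda>i. Y m i - y i) \<in> ell2 \<and> ell2_norm (\<lambda>i. Y m i - y i) \<le> e"
    if L: "\<forall>m\<ge>L. \<forall>n\<ge>L. D m n < e" and m: "m \<ge> L" for L m e
  proof -
    have "\<forall>\<^sub>F n in sequentially. (\<lambda>i. Y m i - Y n i) \<in> ell2 \<and> ell2_norm (\<lambda>i. Y m i - Y n i) \<le> e"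
      using eventually_ge_at_top[of L]
    proof eventually_elim
      case (elim n)
      then have "D m n \<le> e" using L m by (simp add: less_imp_le)
      then show ?case using order_trans[OF Yc] ell2_diff(1)[OF Y2 Y2] by blast
    qed
    then show ?thesis
      using ell2_fatou[of "\<lambda>n i. Y m i - Y n i" "\<lambda>i. Y m i - y i"] tendsto_diff[OF tendsto_const Ylim] by blast
  qed
  obtain L1 where L1: "\<forall>m\<ge>L1. \<forall>n\<ge>L1. D m n < 1" using cauchy[of 1] by auto
  have "(\<lambda>i. Y L1 i - (Y L1 i - y i)) \<in> ell2"
    using ell2_diff(1)[OF Y2 conjunct1[OF tailY[OF L1 order_refl]]] .
  then have y2: "y \<in> ell2" by simp
  have Yy: "(\<lambda>i. Y m i - y i) \<in> ell2" for m by (rule ell2_diff(1)[OF Y2 y2])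
  have YlimN: "(\<lambda>n. ell2_norm (\<lambda>i. Y n i - y i)) \<longlonglongrightarrow> 0"
  proof (rule LIMSEQ_I)
    fix e :: real assume e: "e > 0"
    obtain L where L: "\<forall>m\<ge>L. \<forall>n\<ge>L. D m n < e / 2" using cauchy[of "e / 2"] e by auto
    have "norm (ell2_norm (\<lambda>i. Y n i - y i) - 0) < e" if "n \<ge> L" for n
      using tailY[OF L that] ell2_norm_nonneg[OF Yy, of n] e by simp
    then show "\<exists>L. \<forall>n\<ge>L. norm (ell2_norm (\<lambda>i. Y n i - y i) - 0) < e" by blast
  qed
  \<comment> \<open>\<open>kp_pointwise_continuous\<close> requires convergence of the second
    components in norm, so \<open>YlimN\<close> has to come before this step.\<close>
  have tailX: "(\<lambda>i. X m i - x i - kp (\<lambda>i. Y m i - y i) i) \<in> ell2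
      \<and> ell2_norm (\<lambda>i. X m i - x i - kp (\<lambda>i. Y m i - y i) i) \<le> e"
    if L: "\<forall>m\<ge>L. \<forall>n\<ge>L. D m n < e" and m: "m \<ge> L" for L m e
  proof -
    define W where "W = (\<lambda>n i. X m i - X n i - kp (\<lambda>i. Y m i - Y n i) i)"
    have W: "W n \<in> ell2" for n using dC[of m n] by (simp add: W_def kalton_peck_simps)
    have WD: "ell2_norm (W n) \<le> D m n" for n
      using ell2_norm_nonneg[OF ell2_diff(1)[OF Y2 Y2], of m n] by (simp add: D_eq kalton_peck_simps(4) W_def)
    have bound: "\<forall>\<^sub>F n in sequentially. W n \<in> ell2 \<and> ell2_norm (W n) \<le> e"
      using eventually_ge_at_top[of L]
    proof eventually_elim
      case (elim n)
      then have "D m n \<le> e" using L m by (simp add: less_imp_le)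
      then show ?case using order_trans[OF WD] W by blast
    qed
    have "(\<lambda>n. kp (\<lambda>i. Y m i - Y n i) i) \<longlonglongrightarrow> kp (\<lambda>i. Y m i - y i) i" for i
    proof (rule kp_pointwise_continuous[OF ell2_diff(1)[OF Y2 Y2] Yy])
      have "(\<lambda>n. ell2_norm (\<lambda>i. Y m i - Y n i - (Y m i - y i))) = (\<lambda>n. ell2_norm (\<lambda>i. Y n i - y i))"
        by (subst ell2_norm_minus_commute) simp
      then show "(\<lambda>n. ell2_norm (\<lambda>i. Y m i - Y n i - (Y m i - y i))) \<longlonglongrightarrow> 0" using YlimN by simp
    qed
    then have "(\<lambda>n. W n i) \<longlonglongrightarrow> X m i - x i - kp (\<lambda>i. Y m i - y i) i" for i
      unfolding W_def by (intro tendsto_diff tendsto_const Xlim)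
    from ell2_fatou[OF this bound] show ?thesis by blast
  qed
  have "(\<lambda>j. X L1 j - x j, \<lambda>j. Y L1 j - y j) \<in> qcarrier kalton_peck"
    using tailX[OF L1, of L1] Yy by (simp add: kalton_peck_simps)
  \<comment> \<open>The limit is \<open>s L1\<close> minus the difference of \<open>s L1\<close> and
    the limit, both already in the carrier.\<close>
  from kalton_peck_diff[OF sC[of L1] this]
  have z: "(x, y) \<in> qcarrier kalton_peck" by (simp add: s_eq)
  have "(\<lambda>n. qdist kalton_peck (s n) (x, y)) \<longlonglongrightarrow> 0"
  proof (rule LIMSEQ_I)
    fix e :: real assume e: "e > 0"
    obtain L where L: "\<forall>m\<ge>L. \<forall>n\<ge>L. D m n < e / 3" using cauchy[of "e / 3"] e by auto
    have "norm (qdist kalton_peck (s n) (x, y) - 0) < e" if "n \<ge> L" for n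
    proof -
      have "qdist kalton_peck (s n) (x, y) = ell2_norm (\<lambda>i. X n i - x i - kp (\<lambda>i. Y n i - y i) i)
          + ell2_norm (\<lambda>i. Y n i - y i)"
        by (simp add: s_eq kalton_peck_simps)
      moreover have "0 \<le> ell2_norm (\<lambda>i. X n i - x i - kp (\<lambda>i. Y n i - y i) i)"
        "0 \<le> ell2_norm (\<lambda>i. Y n i - y i)"
        using tailX[OF L that] tailY[OF L that] by (auto intro: ell2_norm_nonneg)
      ultimately show ?thesis using tailX[OF L that] tailY[OF L that] e by simp
    qed
    then show "\<exists>L. \<forall>n\<ge>L. norm (qdist kalton_peck (s n) (x, y) - 0) < e" by blast
  qed
  then show ?thesis using z by blast
qed

interpretation kalton_peck: complete_qnspace kalton_peck 7
proof
  show "(1::real) \<le> 7" by simp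
next
  fix s assume "s \<in> qCauchy kalton_peck"
  then show "\<exists>z\<in>qcarrier kalton_peck. (\<lambda>n. qdist kalton_peck (s n) z) \<longlonglongrightarrow> 0"
    by (rule kalton_peck_complete)
next
  fix p r assume pr: "p \<in> qcarrier kalton_peck" "r \<in> qcarrier kalton_peck"
  obtain x y x' y' where p: "p = (x, y)" and r: "r = (x', y')" by (metis surj_pair)
  have d: "(\<lambda>j. x j - x' j, \<lambda>j. y j - y' j) \<in> qcarrier kalton_peck"
    "(\<lambda>j. x' j - x j, \<lambda>j. y' j - y j) \<in> qcarrier kalton_peck"
    using kalton_peck_diff[OF pr] kalton_peck_diff[OF pr(2,1)] by (simp_all add: p r)
  show "qadd kalton_peck p r \<in> qcarrier kalton_peck" by (rule kalton_peck_add(1)[OF pr])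
  show "p = r" if "qdist kalton_peck p r = 0"
  proof -
    have "qnorm kalton_peck (\<lambda>j. x j - x' j, \<lambda>j. y j - y' j) = 0"
      using that by (simp only: p r kalton_peck_simps(5))
    from kalton_peck_norm(2)[OF d(1) this]
    have "x j - x' j = 0" "y j - y' j = 0" for j by (simp_all add: fun_eq_iff)
    then show ?thesis by (simp add: p r fun_eq_iff)
  qed
  show "qdist kalton_peck p r = qdist kalton_peck r p"
    using kalton_peck_scale(2)[OF d(1), of "- 1"] by (simp add: p r kalton_peck_simps(3,5))
  show "qdist kalton_peck (qscale kalton_peck c p) (qscale kalton_peck c r) = cmod c * qdist kalton_peck p r" for c
    using kalton_peck_scale(2)[OF d(1), of c] by (simp add: p r kalton_peck_simps(3,5) right_diff_distrib)
  show "qnorm kalton_peck p \<le> 7 * (qnorm kalton_peck r + qdist kalton_peck p r)"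
    using kalton_peck_add(2)[OF pr(2) d(1)] by (simp add: p r kalton_peck_simps(2,5))
  fix p' assume p': "p' \<in> qcarrier kalton_peck"
  obtain x'' y'' where p'_eq: "p' = (x'', y'')" by (metis surj_pair)
  have d': "(\<lambda>j. x' j - x'' j, \<lambda>j. y' j - y'' j) \<in> qcarrier kalton_peck"
    using kalton_peck_diff[OF pr(2) p'] by (simp add: r p'_eq)
  show "qdist kalton_peck p p' \<le> 7 * (qdist kalton_peck p r + qdist kalton_peck r p')"
    using kalton_peck_add(2)[OF d(1) d'] by (simp add: p r p'_eq kalton_peck_simps(2,5))
  fix r' assume r': "r' \<in> qcarrier kalton_peck"
  obtain a b where r'_eq: "r' = (a, b)" by (metis surj_pair)
  have e: "(\<lambda>j. x j - x'' j, \<lambda>j. y j - y'' j) \<in> qcarrier kalton_peck"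
    "(\<lambda>j. x' j - a j, \<lambda>j. y' j - b j) \<in> qcarrier kalton_peck"
    using kalton_peck_diff[OF pr(1) p'] kalton_peck_diff[OF pr(2) r'] by (simp_all add: p r p'_eq r'_eq)
  show "qdist kalton_peck (qadd kalton_peck p r) (qadd kalton_peck p' r')
      \<le> 7 * (qdist kalton_peck p p' + qdist kalton_peck r r')"
    using kalton_peck_add(2)[OF e] by (simp add: p r p'_eq r'_eq kalton_peck_simps(2,5) add_diff_add)
qed (use kalton_peck_norm(1) kalton_peck_scale(1) in auto)

section \<open>Density of the finitely supported pairs\<close>

lemma kp_c00: "y \<in> c00 \<Longrightarrow> kp y \<in> c00"
  unfolding c00_def mem_Collect_eq
  by (erule finite_subset[rotated]) (auto simp: supp_def kp_def kp_unit_def)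

lemma c00_kalton_peck:
  assumes "x \<in> c00" "y \<in> c00" shows "(x, y) \<in> qcarrier kalton_peck"
  using c00_add[OF assms(1) c00_scale[OF kp_c00[OF assms(2)], of "- 1"]] assms(2)
  by (simp add: kalton_peck_simps c00_ell2)

text \<open>The tail of \<open>y\<close> is normalized by its own norm \<open>t n\<close> instead of
  \<open>ell2_norm y\<close>. Besides the tail of \<open>x - kp y\<close> this leaves a multiple of
  the tail of \<open>y\<close> with coefficient \<open>ln (t n / ell2_norm y)\<close>, whose norm is
  of the form t |ln t| and tends to 0.\<close>

lemma kalton_peck_truncation:
  assumes z: "(x, y) \<in> qcarrier kalton_peck"
  shows "(\<lambda>n. qdist kalton_peck (restr {..<n} x, restr {..<n} y) (x, y)) \<longlonglongrightarrow> 0"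
proof -
  have y: "y \<in> ell2" and d: "(\<lambda>j. x j - kp y j) \<in> ell2" using z by (simp_all add: kalton_peck_simps)
  define d where "d = (\<lambda>j. x j - kp y j)"
  define Y where "Y = (\<lambda>n j. restr {..<n} y j - y j)"
  define Dt where "Dt = (\<lambda>n j. d j - restr {..<n} d j)"
  define t where "t = (\<lambda>n. ell2_norm (Y n))"
  have Yneg: "Y n = (\<lambda>j. - 1 * (y j - restr {..<n} y j))" for n by (simp add: Y_def)
  have Y2: "Y n \<in> ell2" for n unfolding Yneg by (intro ell2_scale ell2_tail y)
  have t_eq: "t n = ell2_norm (\<lambda>j. y j - restr {..<n} y j)" for n
    unfolding t_def Y_def by (rule ell2_norm_minus_commute)
  have t0: "t \<longlonglongrightarrow> 0" unfolding t_eq by (rule ell2_tail(2)[OF y])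
  have Dt2: "Dt n \<in> ell2" for n unfolding Dt_def by (rule ell2_tail(1)) (simp add: d_def d)
  have D0: "(\<lambda>n. ell2_norm (Dt n)) \<longlonglongrightarrow> 0"
    unfolding Dt_def by (rule ell2_tail(2)) (simp add: d_def d)
  have le: "qdist kalton_peck (restr {..<n} x, restr {..<n} y) (x, y)
      \<le> ell2_norm (Dt n) + \<bar>t n * ln (t n / ell2_norm y)\<bar> + t n" for n
  proof -
    define c where "c = complex_of_real (ln (t n / ell2_norm y))"
    have "restr {..<n} x j - x j - kp (Y n) j = - 1 * Dt n j + c * Y n j" for j
    proof (cases "j < n \<or> y j = 0")
      case True
      then have Yj: "Y n j = 0" by (auto simp: Y_def restr_def)
      then have "kp (Y n) j = 0" by (simp add: kp_eq[OF Y2])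
      then show ?thesis using True Yj by (auto simp: Dt_def restr_def kp_eq[OF y] d_def)
    next
      case False
      then have Yj: "Y n j = - y j" and Dj: "Dt n j = d j" by (auto simp: Y_def Dt_def restr_def)
      have "0 < cmod (Y n j)" using False Yj by simp
      also have "\<dots> \<le> t n" unfolding t_def by (rule cmod_le_ell2_norm[OF Y2])
      finally have tp: "0 < t n" .
      have "0 < cmod (y j)" using False by simp
      also have "\<dots> \<le> ell2_norm y" by (rule cmod_le_ell2_norm[OF y])
      finally have "0 < ell2_norm y" .
      then have ln: "ln (cmod (y j) / t n) = ln (cmod (y j) / ell2_norm y) - ln (t n / ell2_norm y)"
        using False tp by (simp add: ln_div)
      have "kp (Y n) j = - y j * complex_of_real (ln (cmod (y j) / t n))"
        by (simp add: kp_eq[OF Y2] Yj t_def)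
      then show ?thesis unfolding ln using False
        by (simp add: Yj Dj d_def kp_eq[OF y] c_def restr_def algebra_simps)
    qed
    then have eq: "(\<lambda>j. restr {..<n} x j - x j - kp (Y n) j) = (\<lambda>j. - 1 * Dt n j + c * Y n j)" by blast
    have "ell2_norm (\<lambda>j. - 1 * Dt n j + c * Y n j) \<le> ell2_norm (\<lambda>j. - 1 * Dt n j) + ell2_norm (\<lambda>j. c * Y n j)"
      by (intro ell2_add ell2_scale Dt2 Y2)
    also have "\<dots> = ell2_norm (Dt n) + cmod c * t n"
      using ell2_scale(2)[OF Dt2, of "- 1" n] ell2_scale(2)[OF Y2, of c n] by (simp add: t_def)
    also have "cmod c * t n = \<bar>t n * ln (t n / ell2_norm y)\<bar>"
      using ell2_norm_nonneg[OF Y2, of n] by (simp add: c_def t_def abs_mult)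
    finally have "ell2_norm (\<lambda>j. restr {..<n} x j - x j - kp (Y n) j) + ell2_norm (Y n)
        \<le> ell2_norm (Dt n) + \<bar>t n * ln (t n / ell2_norm y)\<bar> + t n"
      unfolding eq by (simp add: t_def)
    then show ?thesis by (simp add: kalton_peck_simps Y_def)
  qed
  have "(\<lambda>n. ell2_norm (Dt n) + \<bar>t n * ln (t n / ell2_norm y)\<bar> + t n) \<longlonglongrightarrow> 0 + 0 + 0"
  proof (intro tendsto_add D0 t0 tendsto_rabs_zero)
    have nn: "0 \<le> t n" for n using ell2_norm_nonneg[OF Y2] by (simp add: t_def)
    have "(\<lambda>n. complex_of_real (t n / ell2_norm y)) \<longlonglongrightarrow> complex_of_real (0 / ell2_norm y)"
      using t0 by (intro tendsto_of_real) (simp add: divide_inverse tendsto_mult_left_zero)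
    moreover have "cmod (complex_of_real (t n / ell2_norm y)) = t n / ell2_norm y" for n
      unfolding norm_of_real using nn ell2_norm_nonneg[OF y] by simp
    ultimately
    have "(\<lambda>n. complex_of_real (t n / ell2_norm y * ln (t n / ell2_norm y))) \<longlonglongrightarrow> complex_of_real 0"
      using tendsto_mult_ln_cmod[of "\<lambda>n. complex_of_real (t n / ell2_norm y)" 0] by simp
    then have "(\<lambda>n. t n / ell2_norm y * ln (t n / ell2_norm y)) \<longlonglongrightarrow> 0"
      unfolding tendsto_of_real_iff .
    from tendsto_mult[OF tendsto_const this, of "ell2_norm y"]
    \<comment> \<open>If \<open>ell2_norm y = 0\<close>, the quotients are 0 by the convention for
      division and \<open>ln 0 = 0\<close>, so the sequence is constantly 0.\<close>
    show "(\<lambda>n. t n * ln (t n / ell2_norm y)) \<longlonglongrightarrow> 0"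
      by (cases "ell2_norm y = 0") simp_all
  qed
  then have lim: "(\<lambda>n. ell2_norm (Dt n) + \<bar>t n * ln (t n / ell2_norm y)\<bar> + t n) \<longlonglongrightarrow> 0" by simp
  have nn: "0 \<le> qdist kalton_peck (restr {..<n} x, restr {..<n} y) (x, y)" for n
  proof (intro kalton_peck.qdist_nonneg z)
    show "(restr {..<n} x, restr {..<n} y) \<in> qcarrier kalton_peck"
      by (intro c00_kalton_peck restr_c00) simp_all
  qed
  show ?thesis by (rule tendsto_0_le_real[OF lim nn le])
qed

section \<open>Tsirelson's space, duality and factorizations\<close>

lemma admissible_less:
  assumes A: "admissible k A" and "i < j" "j < k" "p \<in> A i" "r \<in> A j"
  shows "p < r"
proof -
  have fin: "finite (A m)" "A m \<noteq> {}" if "m < k" for m using A that by (auto simp: admissible_def)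
  have "j < k \<Longrightarrow> Max (A i) < Min (A j)" using \<open>i < j\<close>
  proof (induction j)
    case (Suc j)
    have step: "Max (A j) < Min (A (Suc j))" using A Suc.prems by (auto simp: admissible_def)
    show ?case
    proof (cases "i = j")
      case False
      then have "Max (A i) < Min (A j)" using Suc by simp
      also have "\<dots> \<le> Max (A j)" using fin[of j] Suc.prems by (intro Min_le Max_in) auto
      finally show ?thesis using step by simp
    qed (use step in simp)
  qed simp
  moreover have "p \<le> Max (A i)" "Min (A j) \<le> r" using assms fin[of i] fin[of j] by auto
  ultimately show ?thesis using \<open>j < k\<close> by simp
qed

lemma admissible_disjoint:
  assumes "admissible k A" "i < k" "j < k" "i \<noteq> j" shows "A i \<inter> A j = {}"
proof (cases "i < j")
  case True
  then show ?thesis using admissible_less[OF assms(1) True assms(3)] by blast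
next
  case False
  then have "j < i" using assms(4) by simp
  then show ?thesis using admissible_less[OF assms(1) _ assms(2)] by blast
qed

text \<open>Witnesses that the set under \<open>Sup\<close> in \<open>tsirelson_approx\<close> is
  not empty.\<close>

lemma admissible_singleton: "admissible 1 (\<lambda>_. {0})"
  by (simp add: admissible_def)

lemma supp_restr: "supp (restr A x) = supp x \<inter> A"
  by (auto simp: supp_def restr_def)

lemma restr_in_c00: "x \<in> c00 \<Longrightarrow> restr A x \<in> c00"
  by (simp add: c00_def supp_restr)

lemma sum_admissible_le:
  assumes x: "x \<in> c00" and A: "admissible k A"
  shows "(\<Sum>j<k. \<Sum>i\<in>supp (restr (A j) x). cmod (restr (A j) x i)) \<le> (\<Sum>i\<in>supp x. cmod (x i))"
proof -
  have fin: "finite (supp x)" using x by (simp add: c00_def)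
  have "(\<Sum>j<k. \<Sum>i\<in>supp (restr (A j) x). cmod (restr (A j) x i))
      = (\<Sum>j<k. \<Sum>i\<in>supp x \<inter> A j. cmod (x i))"
    unfolding supp_restr by (intro sum.cong refl) (auto simp: restr_def)
  also have "\<dots> = (\<Sum>i\<in>(\<Union>j<k. supp x \<inter> A j). cmod (x i))"
    using fin admissible_disjoint[OF A] by (intro sum.UNION_disjoint[symmetric]) auto
  also have "\<dots> \<le> (\<Sum>i\<in>supp x. cmod (x i))"
    using fin by (intro sum_mono2) auto
  finally show ?thesis .
qed

text \<open>Admissible sets are disjoint, so the sum of moduli survives the recursion. The bound
  keeps the suprema finite and makes the increasing approximations converge.\<close>

lemma tsirelson_approx_bounds:
  "x \<in> c00 \<Longrightarrow> 0 \<le> tsirelson_approx n x \<and> tsirelson_approx n x \<le> (\<Sum>i\<in>supp x. cmod (x i))"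
proof (induction n arbitrary: x)
  case 0
  have fin: "finite (supp x)" using 0 by (simp add: c00_def)
  have le: "cmod (x j) \<le> (\<Sum>i\<in>supp x. cmod (x i))" for j
  proof (cases "j \<in> supp x")
    case True
    then show ?thesis using fin by (intro member_le_sum) auto
  qed (simp add: supp_def sum_nonneg)
  have "cmod (x 0) \<le> (SUP j. cmod (x j))"
    using le by (intro cSUP_upper bdd_aboveI2) auto
  moreover have "(SUP j. cmod (x j)) \<le> (\<Sum>i\<in>supp x. cmod (x i))"
    using le by (intro cSUP_least) auto
  ultimately show ?case using norm_ge_zero[of "x 0"] unfolding tsirelson_approx.simps by linarith
next
  case (Suc n)
  have le: "(\<Sum>j<k. tsirelson_approx n (restr (A j) x)) \<le> (\<Sum>i\<in>supp x. cmod (x i))"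
    if A: "admissible k A" for k A
  proof -
    have "(\<Sum>j<k. tsirelson_approx n (restr (A j) x))
        \<le> (\<Sum>j<k. \<Sum>i\<in>supp (restr (A j) x). cmod (restr (A j) x i))"
      using Suc.IH[OF restr_in_c00[OF Suc.prems]] by (intro sum_mono) simp
    also have "\<dots> \<le> (\<Sum>i\<in>supp x. cmod (x i))" by (rule sum_admissible_le[OF Suc.prems A])
    finally show ?thesis .
  qed
  have "Sup {\<Sum>j<k. tsirelson_approx n (restr (A j) x) | k A. admissible k A} \<le> (\<Sum>i\<in>supp x. cmod (x i))"
    by (rule cSup_least) (use le admissible_singleton in blast)+
  moreover have "0 \<le> (\<Sum>i\<in>supp x. cmod (x i))" by (rule sum_nonneg) simp
  ultimately show ?case using Suc.IH[OF Suc.prems] by (auto simp: max_def)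
qed

lemma tsirelson_approx_admissible:
  assumes x: "x \<in> c00" and A: "admissible k A"
  shows "(\<Sum>j<k. tsirelson_approx n (restr (A j) x)) \<le> 2 * tsirelson_approx (Suc n) x"
proof -
  have "bdd_above {\<Sum>j<k. tsirelson_approx n (restr (A j) x) | k A. admissible k A}"
  proof (rule bdd_aboveI)
    fix s assume "s \<in> {\<Sum>j<k. tsirelson_approx n (restr (A j) x) | k A. admissible k A}"
    then obtain k A where s: "s = (\<Sum>j<k. tsirelson_approx n (restr (A j) x))" and A: "admissible k A" by blast
    have "s \<le> (\<Sum>j<k. \<Sum>i\<in>supp (restr (A j) x). cmod (restr (A j) x i))"
      unfolding s using tsirelson_approx_bounds[OF restr_in_c00[OF x]] by (intro sum_mono) simp
    also have "\<dots> \<le> (\<Sum>i\<in>supp x. cmod (x i))" by (rule sum_admissible_le[OF x A])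
    finally show "s \<le> (\<Sum>i\<in>supp x. cmod (x i))" .
  qed
  then have "(\<Sum>j<k. tsirelson_approx n (restr (A j) x))
      \<le> Sup {\<Sum>j<k. tsirelson_approx n (restr (A j) x) | k A. admissible k A}"
    using A by (intro cSup_upper) auto
  then show ?thesis by simp
qed

lemma tsirelson_norm_tendsto:
  assumes x: "x \<in> c00"
  shows "(\<lambda>n. tsirelson_approx n x) \<longlonglongrightarrow> tsirelson_norm x"
    and "tsirelson_approx n x \<le> tsirelson_norm x"
proof -
  have inc: "incseq (\<lambda>n. tsirelson_approx n x)" by (rule incseq_SucI) simp
  then obtain L where L: "(\<lambda>n. tsirelson_approx n x) \<longlonglongrightarrow> L"
    using tsirelson_approx_bounds[OF x] incseq_convergent[of "\<lambda>n. tsirelson_approx n x"] by blast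
  then show lim: "(\<lambda>n. tsirelson_approx n x) \<longlonglongrightarrow> tsirelson_norm x"
    by (simp add: tsirelson_norm_def limI)
  show "tsirelson_approx n x \<le> tsirelson_norm x" by (rule incseq_le[OF inc lim])
qed

lemma tsirelson_norm_nonneg: "x \<in> c00 \<Longrightarrow> 0 \<le> tsirelson_norm x"
  using tsirelson_norm_tendsto(2)[of x 0] tsirelson_approx_bounds[of x 0] by simp

text \<open>The lower estimate of type \<ell>1 on admissible families, obtained from the recursion
  in the limit. Later it controls the restrictions of a factor \<open>V\<close> to the
  blocks.\<close>

lemma tsirelson_norm_admissible:
  assumes x: "x \<in> c00" and A: "admissible k A"
  shows "(\<Sum>j<k. tsirelson_norm (restr (A j) x)) \<le> 2 * tsirelson_norm x"
proof (rule LIMSEQ_le_const2)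
  show "(\<lambda>n. \<Sum>j<k. tsirelson_approx n (restr (A j) x)) \<longlonglongrightarrow> (\<Sum>j<k. tsirelson_norm (restr (A j) x))"
    by (intro tendsto_sum tsirelson_norm_tendsto(1) restr_in_c00 x)
  have "(\<Sum>j<k. tsirelson_approx n (restr (A j) x)) \<le> 2 * tsirelson_norm x" for n
    using tsirelson_approx_admissible[OF x A, of n] tsirelson_norm_tendsto(2)[OF x, of "Suc n"] by linarith
  then show "\<exists>N. \<forall>n\<ge>N. (\<Sum>j<k. tsirelson_approx n (restr (A j) x)) \<le> 2 * tsirelson_norm x" by blast
qed

text \<open>Only moduli enter the recursion; this lets the duality argument rotate phases
  freely.\<close>

lemma tsirelson_approx_cong:
  "(\<And>i. cmod (x i) = cmod (y i)) \<Longrightarrow> tsirelson_approx n x = tsirelson_approx n y"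
proof (induction n arbitrary: x y)
  case (Suc n)
  have r: "tsirelson_approx n (restr A x) = tsirelson_approx n (restr A y)" for A
    by (rule Suc.IH) (simp add: restr_def Suc.prems)
  show ?case using Suc.IH[OF Suc.prems] by (simp add: r)
qed simp

lemma tsirelson_norm_cong: "(\<And>i. cmod (x i) = cmod (y i)) \<Longrightarrow> tsirelson_norm x = tsirelson_norm y"
  unfolding tsirelson_norm_def using tsirelson_approx_cong[of x y] by simp

lemma zero_c00: "(\<lambda>_. 0) \<in> c00"
  by (simp add: c00_def supp_def)

lemma unit_seq_c00: "unit_seq j \<in> c00"
  unfolding c00_def supp_def unit_seq_def mem_Collect_eq by (rule finite_subset[of _ "{j}"]) auto

lemma tsirelson_norm_zero: "tsirelson_norm (\<lambda>_. 0) = 0"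
proof -
  have "tsirelson_approx n (\<lambda>_. 0) = 0" for n
    using tsirelson_approx_bounds[OF zero_c00, of n] by (simp add: supp_def)
  then show ?thesis by (simp add: tsirelson_norm_def)
qed

lemma tsirelson_norm_unit_seq: "0 < tsirelson_norm (unit_seq 0)"
proof -
  have "cmod (unit_seq 0 0) \<le> (SUP j. cmod (unit_seq 0 j))"
    by (intro cSUP_upper bdd_aboveI2[of _ _ 1]) (auto simp: unit_seq_def)
  then have "1 \<le> tsirelson_approx 0 (unit_seq 0)" by (simp add: unit_seq_def)
  then show ?thesis using tsirelson_norm_tendsto(2)[OF unit_seq_c00, of 0 0] by linarith
qed

section \<open>Duality and the pairing of moduli\<close>

lemma c00_seq_space:
  assumes N0: "N (\<lambda>_. 0) = 0" and x: "x \<in> c00"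
  shows "x \<in> seq_space N" "seq_norm N x = N x"
proof -
  have fin: "finite (supp x)" using x by (simp add: c00_def)
  then obtain m where m: "\<And>i. i \<in> supp x \<Longrightarrow> i < m" using finite_nat_bounded by blast
  \<comment> \<open>Truncations are constant beyond the support, which settles both the Cauchy
    condition and the limit.\<close>
  have eq: "restr {..<n} x = x" if "n \<ge> m" for n
    using m that by (fastforce simp: restr_def supp_def fun_eq_iff)
  then show "x \<in> seq_space N" unfolding seq_space_def using N0 by (auto intro!: exI[of _ m])
  have "(\<lambda>n. N (restr {..<n} x)) \<longlonglongrightarrow> N x"
    by (rule tendsto_eventually, rule eventually_mono[OF eventually_ge_at_top[of m]]) (simp add: eq)
  then show "seq_norm N x = N x" unfolding seq_norm_def by (rule limI)
qed

lemma functional_bounded_byD: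
  assumes "functional_bounded_by N C \<phi>" "x \<in> seq_space N"
  shows "y \<in> seq_space N \<Longrightarrow> \<phi> (\<lambda>j. x j + y j) = \<phi> x + \<phi> y"
    and "\<phi> (\<lambda>j. c * x j) = c * \<phi> x" and "cmod (\<phi> x) \<le> C * seq_norm N x"
  using assms unfolding functional_bounded_by_def by blast+

lemma functional_c00:
  assumes N0: "N (\<lambda>_. 0) = 0" and \<phi>: "functional_bounded_by N C \<phi>" and F: "finite F"
  shows "\<phi> (restr F x) = (\<Sum>j\<in>F. x j * \<phi> (unit_seq j))"
  using F
proof (induction F)
  case empty
  show ?case
    using functional_bounded_byD(2)[OF \<phi> c00_seq_space(1)[of N, OF N0 zero_c00], of 0]
    by (simp add: restr_def)
next
  case (insert m F)
  note S = c00_seq_space(1)[of N, OF N0]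
  have u: "\<phi> (\<lambda>j. x m * unit_seq m j) = x m * \<phi> (unit_seq m)"
    by (rule functional_bounded_byD(2)[OF \<phi> S[OF unit_seq_c00]])
  have "restr (insert m F) x = (\<lambda>j. restr F x j + x m * unit_seq m j)"
    using insert.hyps by (auto simp: restr_def unit_seq_def)
  moreover have "\<phi> (\<lambda>j. restr F x j + x m * unit_seq m j) = \<phi> (restr F x) + \<phi> (\<lambda>j. x m * unit_seq m j)"
    by (intro functional_bounded_byD(1)[OF \<phi>] S restr_c00 c00_scale unit_seq_c00 insert.hyps)
  ultimately show ?case using insert u by simp
qed

text \<open>Rotating the phases of \<open>x\<close> against those of \<open>w\<close> turns the
  value of the functional into the sum of moduli without changing \<open>N x\<close>. The infimum in
  \<open>dual_norm\<close> need not be attained, so bounds \<open>C < 1 + d\<close> are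
  used.\<close>

lemma duality:
  assumes N0: "N (\<lambda>_. 0) = 0" and N1: "0 < N (unit_seq 0)"
    and cong: "\<And>x y. (\<And>i. cmod (x i) = cmod (y i)) \<Longrightarrow> N x = N y"
    and nonneg: "\<And>x. x \<in> c00 \<Longrightarrow> 0 \<le> N x"
    and w: "w \<in> dual_space N" "dual_norm N w \<le> 1" and x: "x \<in> c00" and F: "finite F"
  shows "(\<Sum>i\<in>F. cmod (x i) * cmod (w i)) \<le> N x"
proof -
  define X where "X = {C. 0 \<le> C \<and> (\<exists>\<phi>. functional_bounded_by N C \<phi> \<and> (\<forall>j. w j = \<phi> (unit_seq j)))}"
  obtain \<phi> C where \<phi>: "functional_bounded_by N C \<phi>" "\<forall>j. w j = \<phi> (unit_seq j)"
    using w(1) by (auto simp: dual_space_def)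
  \<comment> \<open>\<open>dual_space\<close> puts no sign condition on \<open>C\<close>, but the
    set in \<open>dual_norm\<close> asks for \<open>0 \<le> C\<close>. Testing on one basis vector
    supplies it, so that set is not empty.\<close>
  have "cmod (\<phi> (unit_seq 0)) \<le> C * N (unit_seq 0)"
    using functional_bounded_byD(3)[OF \<phi>(1), of "unit_seq 0"] c00_seq_space[of N, OF N0 unit_seq_c00, of 0]
    by simp
  then have "0 \<le> C * N (unit_seq 0)" using norm_ge_zero order_trans by blast
  then have "0 \<le> C" using N1 by (simp add: zero_le_mult_iff)
  then have "X \<noteq> {}" using \<phi> by (auto simp: X_def)
  define G where "G = F \<union> supp x"
  have G: "finite G" using F x by (simp add: G_def c00_def)
  define s where "s = (\<lambda>i. if w i = 0 then 1 else cnj (sgn (w i)))"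
  define y where "y = (\<lambda>i. complex_of_real (cmod (x i)) * s i)"
  have s1: "cmod (s i) = 1" for i by (simp add: s_def norm_sgn)
  have sw: "s i * w i = complex_of_real (cmod (w i))" for i
  proof (cases "w i = 0")
    case False
    have "cnj (w i) * w i = complex_of_real (cmod (w i)) * complex_of_real (cmod (w i))"
      using complex_norm_square[of "w i"] by (simp add: power2_eq_square mult.commute)
    then show ?thesis using False by (simp add: s_def sgn_eq field_simps)
  qed (simp add: s_def)
  have y: "restr G y = y" by (auto simp: G_def restr_def y_def supp_def)
  have Ny: "N y = N x" by (rule cong) (simp add: y_def norm_mult s1)
  have le: "(\<Sum>i\<in>G. cmod (x i) * cmod (w i)) \<le> C * N x" if "C \<in> X" for C
  proof -
    obtain \<phi> where \<phi>: "functional_bounded_by N C \<phi>" and w: "\<And>j. \<phi> (unit_seq j) = w j"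
      using \<open>C \<in> X\<close> by (auto simp: X_def)
    have "\<phi> y = (\<Sum>j\<in>G. y j * w j)" using functional_c00[OF N0 \<phi> G, of y] by (simp add: y w)
    also have "\<dots> = complex_of_real (\<Sum>i\<in>G. cmod (x i) * cmod (w i))"
      by (simp add: y_def mult.assoc sw)
    finally have "cmod (\<phi> y) = (\<Sum>i\<in>G. cmod (x i) * cmod (w i))"
      by (simp only: norm_of_real) (simp add: sum_nonneg)
    moreover have "y \<in> c00" using restr_c00[OF G, of y] by (simp add: y)
    then have "cmod (\<phi> y) \<le> C * N y"
      using functional_bounded_byD(3)[OF \<phi>, of y] c00_seq_space[of N, OF N0, of y] by simp
    ultimately show ?thesis by (simp add: Ny)
  qed
  have "(\<Sum>i\<in>G. cmod (x i) * cmod (w i)) \<le> N x + e" if "e > 0" for e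
  proof -
    \<comment> \<open>The summand 1 avoids division by zero; \<open>d\<close> is small enough for
      \<open>d * N x \<le> e\<close>.\<close>
    define d where "d = e / (N x + 1)"
    have d: "0 < d" "d * N x \<le> e"
      using nonneg[OF x] that by (auto simp: d_def field_simps)
    have "Inf X < 1 + d" using w(2) d by (simp add: dual_norm_def X_def)
    then obtain C where C: "C \<in> X" "C < 1 + d" using cInf_lessD \<open>X \<noteq> {}\<close> by blast
    have "C * N x \<le> (1 + d) * N x" using C nonneg[OF x] by (intro mult_right_mono) auto
    then show ?thesis using le[OF C(1)] d by (simp add: algebra_simps)
  qed
  then have "(\<Sum>i\<in>G. cmod (x i) * cmod (w i)) \<le> N x" by (rule field_le_epsilon)
  moreover have "(\<Sum>i\<in>F. cmod (x i) * cmod (w i)) \<le> (\<Sum>i\<in>G. cmod (x i) * cmod (w i))"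
    using G by (intro sum_mono2) (auto simp: G_def)
  ultimately show ?thesis by simp
qed

lemma tsirelson_duality:
  assumes "w \<in> dual_space tsirelson_norm" "dual_norm tsirelson_norm w \<le> 1" "x \<in> c00" "finite F"
  shows "(\<Sum>i\<in>F. cmod (x i) * cmod (w i)) \<le> tsirelson_norm x"
  by (rule duality[OF tsirelson_norm_zero tsirelson_norm_unit_seq tsirelson_norm_cong tsirelson_norm_nonneg assms])

section \<open>Factorizations and the centralizer on finitely supported vectors\<close>

lemma tsirelson_factorization:
  assumes "lozanovskii_factorization tsirelson_norm u v w" "u \<in> c00"
  shows "v \<in> c00" "tsirelson_norm v \<le> 1" "w \<in> dual_space tsirelson_norm" "dual_norm tsirelson_norm w \<le> 1"
    "supp v = supp u" "supp w = supp u" "(cmod (u i))\<^sup>2 = cmod (v i) * cmod (w i)"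
proof -
  show v: "v \<in> c00" using assms by (simp add: lozanovskii_factorization_def c00_def)
  show "tsirelson_norm v \<le> 1"
    using assms c00_seq_space(2)[of tsirelson_norm, OF tsirelson_norm_zero v] by (simp add: lozanovskii_factorization_def)
qed (use assms in \<open>auto simp: lozanovskii_factorization_def\<close>)

text \<open>At 1/2 both powers equal 1, so differentiating the exponents leaves the difference of
  logarithms. The scalar \<open>c\<close> carries homogeneity along and includes the zero
  vector.\<close>

lemma centralizer_finite:
  assumes B: "selection N B" and u: "u \<in> c00" "ell2_norm u = 1"
  shows "\<exists>v w. lozanovskii_factorization N u v w \<and>
    (\<forall>c. centralizer B (\<lambda>j. c * u j)
      = (\<lambda>j. c * (u j * complex_of_real (ln (cmod (w j)) - ln (cmod (v j))))))"
proof -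
  obtain v w where vw: "lozanovskii_factorization N u v w"
    and Bu: "\<And>z. z \<in> strip \<Longrightarrow> B u z = (\<lambda>j. u j * complex_of_real (cmod (v j)) powr (1/2 - z)
                                   * complex_of_real (cmod (w j)) powr (z - 1/2))"
    using B u unfolding selection_def by blast
  have hom: "B (\<lambda>j. c * u j) z = (\<lambda>j. c * B u z j)" if "z \<in> strip" for c z
    using B c00_ell2[OF u(1)] that unfolding selection_def by blast
  define U where "U = {z. 0 < Re z \<and> Re z < 1}"
  have U: "open U" "1/2 \<in> U" "\<And>z. z \<in> U \<Longrightarrow> z \<in> strip"
    unfolding U_def by (auto simp: strip_def Collect_conj_eq intro: open_halfspace_Re_gt open_halfspace_Re_lt)
  have "centralizer B (\<lambda>j. c * u j) j = c * (u j * complex_of_real (ln (cmod (w j)) - ln (cmod (v j))))" for c j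
  proof -
    define f where "f = (\<lambda>z. c * (u j * complex_of_real (cmod (v j)) powr (1/2 - z)
                                   * complex_of_real (cmod (w j)) powr (z - 1/2)))"
    \<comment> \<open>The formula for \<open>B\<close> holds on the strip; its interior is a
      neighbourhood of 1/2, which is all that \<open>deriv\<close> sees.\<close>
    have "\<forall>\<^sub>F z in nhds (1/2). B (\<lambda>j. c * u j) z j = f z"
      using eventually_nhds_in_open[OF U(1,2)] by eventually_elim (simp add: hom U Bu f_def)
    then have "centralizer B (\<lambda>j. c * u j) j = deriv f (1/2)"
      unfolding centralizer_def by (rule deriv_cong_ev) simp
    also have "\<dots> = c * (u j * complex_of_real (ln (cmod (w j)) - ln (cmod (v j))))"
    proof (cases "u j = 0")
      case False
      then have nz: "0 < cmod (v j)" "0 < cmod (w j)"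
        using vw by (auto simp: lozanovskii_factorization_def supp_def)
      have "(f has_field_derivative c * (u j * complex_of_real (ln (cmod (w j)) - ln (cmod (v j))))) (at (1/2))"
        unfolding f_def using nz
        by (auto intro!: derivative_eq_intros DERIV_chain2[OF has_field_derivative_powr_right]
            simp: Ln_of_real algebra_simps)
      then show ?thesis by (rule DERIV_imp_deriv)
    qed (simp add: f_def)
    finally show ?thesis .
  qed
  then show ?thesis using vw by blast
qed

text \<open>For t = ln r the quadratic Taylor bound gives t^2 / 2 \<le> exp |t| \<le> exp t + exp (-
  t).\<close>

lemma power2_ln_le:
  fixes r :: real assumes "0 < r" shows "(ln r)\<^sup>2 \<le> 2 * (r + 1 / r)"
proof -
  define t where "t = ln r"
  have r: "r = exp t" using assms by (simp add: t_def)
  have "t\<^sup>2 \<le> 2 * exp \<bar>t\<bar>" using exp_lower_Taylor_quadratic[of "\<bar>t\<bar>"] by simp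
  also have "\<dots> \<le> 2 * (exp t + exp (- t))" by (cases "0 \<le> t") (auto simp: less_imp_le)
  finally show ?thesis by (simp add: r exp_minus divide_inverse)
qed

text \<open>As \<open>V W = \<beta>\<^sup>2 v w\<close>, we have \<open>W = r w\<close> and \<open>\<beta>\<^sup>2 v = r V\<close> for the same \<open>r\<close>, and the combination of
  logarithms is \<open>2 ln r\<close>.\<close>

lemma factorization_compare:
  fixes V W v w \<beta> :: real
  assumes pos: "0 < V" "0 < W" "0 < v" "0 < w" "0 < \<beta>" and eq: "V * W = \<beta>\<^sup>2 * (v * w)"
  shows "V * W * (ln W - ln V - (ln w - ln v) + 2 * ln \<beta>)\<^sup>2 \<le> 8 * (\<beta>\<^sup>2 * v * W + V * w)"
proof -
  define r where "r = W / w"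
  have r: "0 < r" using pos by (simp add: r_def)
  have "ln (V * W) = ln (\<beta>\<^sup>2 * (v * w))" using eq by simp
  then have "ln V + ln W = 2 * ln \<beta> + ln v + ln w"
    using pos by (simp add: ln_mult ln_realpow)
  then have "ln W - ln V - (ln w - ln v) + 2 * ln \<beta> = 2 * ln r"
    using pos by (simp add: r_def ln_div)
  then have "V * W * (ln W - ln V - (ln w - ln v) + 2 * ln \<beta>)\<^sup>2 = V * W * (4 * (ln r)\<^sup>2)"
    by (simp add: power_mult_distrib)
  also have "\<dots> \<le> V * W * (4 * (2 * (r + 1 / r)))"
    using pos power2_ln_le[OF r] by (intro mult_left_mono) auto
  also have "\<dots> = 8 * ((V * W) * r + V * W / r)" by (simp add: algebra_simps)
  also have "(V * W) * r = \<beta>\<^sup>2 * v * W" unfolding eq using pos by (simp add: r_def)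
  also have "V * W / r = V * w" using pos by (simp add: r_def)
  finally show ?thesis .
qed

section \<open>Twisted spreading models\<close>

lemma sum_single:
  fixes g :: "nat \<Rightarrow> 'a::comm_monoid_add"
  assumes "m < n" "\<And>j. j < n \<Longrightarrow> j \<noteq> m \<Longrightarrow> g j = 0"
  shows "(\<Sum>j<n. g j) = g m"
  using sum.remove[of "{..<n}" m g] assms by simp

text \<open>\<open>D\<close> measures how far the centralizer at \<open>U\<close> is from its value
  for the glued pair of factors. Every coordinate in \<open>F\<close> belongs to exactly one block,
  where \<open>factorization_compare\<close> applies; duality then sums the bounds.\<close>

lemma factorization_almost_linear:
  fixes b V W :: cseq and u v w :: "nat \<Rightarrow> cseq" and n :: nat
  defines "U \<equiv> \<lambda>i. \<Sum>j<n. b j * u j i"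
  defines "D \<equiv> \<lambda>i. U i * complex_of_real (ln (cmod (W i)) - ln (cmod (V i)))
    - (\<Sum>j<n. b j * (u j i * complex_of_real (ln (cmod (w j i)) - ln (cmod (v j i)))))
    + 2 * (\<Sum>j<n. b j * complex_of_real (ln (cmod (b j))) * u j i)"
  assumes adm: "admissible n (\<lambda>j. supp (u j))"
    and b: "(\<Sum>j<n. (cmod (b j))\<^sup>2) = 1"
    and u: "\<And>j. u j \<in> c00"
    and vw: "\<And>j. lozanovskii_factorization tsirelson_norm (u j) (v j) (w j)"
    and VW: "lozanovskii_factorization tsirelson_norm U V W"
  shows "D \<in> ell2" "ell2_norm D \<le> 5"
proof -
  define F where "F = (\<Union>j<n. supp (u j))"
  have F: "finite F" using u by (auto simp: F_def c00_def)
  have U: "U \<in> c00"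
    unfolding c00_def mem_Collect_eq
    by (rule finite_subset[OF _ F]) (auto simp: U_def F_def supp_def intro: sum.not_neutral_contains_not_neutral)
  note vwD = tsirelson_factorization[OF vw u] and VWD = tsirelson_factorization[OF VW U]
  have pt: "(cmod (D i))\<^sup>2 \<le> 8 * ((\<Sum>j<n. (cmod (b j))\<^sup>2 * (cmod (v j i) * cmod (W i)))
      + (\<Sum>j<n. cmod (V i) * cmod (w j i)))" (is "_ \<le> 8 * (?S + ?T)") if "i \<in> F" for i
  proof -
    have S: "0 \<le> ?S" "0 \<le> ?T" by (auto intro!: sum_nonneg)
    obtain m where m: "m < n" "i \<in> supp (u m)" using \<open>i \<in> F\<close> by (auto simp: F_def)
    have u0: "u j i = 0" if "j < n" "j \<noteq> m" for j
      using admissible_disjoint[OF adm that(1) m(1) that(2)] m(2) by (auto simp: supp_def)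
    have Ui: "U i = b m * u m i" unfolding U_def using m(1) by (intro sum_single) (auto simp: u0)
    define E where "E = ln (cmod (W i)) - ln (cmod (V i)) - (ln (cmod (w m i)) - ln (cmod (v m i)))
      + 2 * ln (cmod (b m))"
    have "(\<Sum>j<n. b j * (u j i * complex_of_real (ln (cmod (w j i)) - ln (cmod (v j i)))))
        = b m * (u m i * complex_of_real (ln (cmod (w m i)) - ln (cmod (v m i))))"
      using m(1) by (intro sum_single) (auto simp: u0)
    moreover have "(\<Sum>j<n. b j * complex_of_real (ln (cmod (b j))) * u j i)
        = b m * complex_of_real (ln (cmod (b m))) * u m i"
      using m(1) by (intro sum_single) (auto simp: u0)
    ultimately have Di: "D i = U i * complex_of_real E"
      unfolding D_def Ui E_def by (simp add: algebra_simps)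
    show ?thesis
    proof (cases "b m = 0")
      case True
      then show ?thesis using S by (simp add: Di Ui)
    next
      case False
      have iU: "i \<in> supp U" using False m(2) by (simp add: supp_def Ui)
      have pos: "0 < cmod (V i)" "0 < cmod (W i)" "0 < cmod (v m i)" "0 < cmod (w m i)" "0 < cmod (b m)"
        using False iU m(2) vwD(5,6)[of m] VWD(5,6) by (auto simp: supp_def)
      have "cmod (V i) * cmod (W i) = (cmod (b m))\<^sup>2 * (cmod (v m i) * cmod (w m i))"
        using VWD(7)[of i] vwD(7)[of m i] by (simp add: Ui norm_mult power_mult_distrib)
      from factorization_compare[OF pos this]
      have "(cmod (D i))\<^sup>2 \<le> 8 * ((cmod (b m))\<^sup>2 * (cmod (v m i) * cmod (W i)) + cmod (V i) * cmod (w m i))"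
        unfolding E_def[symmetric] using VWD(7)[of i]
        by (simp add: Di norm_mult power_mult_distrib mult.assoc)
      \<comment> \<open>Enlarging the term of block \<open>m\<close> to a sum over all blocks
        removes the dependence on \<open>m\<close>, so that the bound can be summed over
        \<open>F\<close>.\<close>
      also have "\<dots> \<le> 8 * (?S + ?T)"
        using m(1) member_le_sum[of m "{..<n}" "\<lambda>j. (cmod (b j))\<^sup>2 * (cmod (v j i) * cmod (W i))"]
          member_le_sum[of m "{..<n}" "\<lambda>j. cmod (V i) * cmod (w j i)"] by simp
      finally show ?thesis .
    qed
  qed
  have "(\<Sum>i\<in>F. \<Sum>j<n. (cmod (b j))\<^sup>2 * (cmod (v j i) * cmod (W i)))
      = (\<Sum>j<n. (cmod (b j))\<^sup>2 * (\<Sum>i\<in>F. cmod (v j i) * cmod (W i)))"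
    unfolding sum_distrib_left by (rule sum.swap)
  \<comment> \<open>\<open>W\<close> has dual norm at most 1 and each \<open>v j\<close> has norm at
    most 1.\<close>
  also have "\<dots> \<le> (\<Sum>j<n. (cmod (b j))\<^sup>2 * 1)"
    using order_trans[OF tsirelson_duality[OF VWD(3,4) vwD(1) F] vwD(2)]
    by (intro sum_mono mult_left_mono) auto
  finally have S: "(\<Sum>i\<in>F. \<Sum>j<n. (cmod (b j))\<^sup>2 * (cmod (v j i) * cmod (W i))) \<le> 1" using b by simp
  have "(\<Sum>i\<in>F. \<Sum>j<n. cmod (V i) * cmod (w j i)) = (\<Sum>j<n. \<Sum>i\<in>F. cmod (V i) * cmod (w j i))"
    by (rule sum.swap)
  \<comment> \<open>Each \<open>w j\<close> lives on the block of \<open>u j\<close>, so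
    \<open>V\<close> may be restricted there; admissibility of the blocks then bounds the sum of the
    restricted norms.\<close>
  also have "\<dots> = (\<Sum>j<n. \<Sum>i\<in>F. cmod (restr (supp (u j)) V i) * cmod (w j i))"
    using vwD(6) by (intro sum.cong refl) (auto simp: restr_def supp_def)
  also have "\<dots> \<le> (\<Sum>j<n. tsirelson_norm (restr (supp (u j)) V))"
    by (intro sum_mono tsirelson_duality vwD(3,4) restr_in_c00 VWD(1) F)
  also have "\<dots> \<le> 2 * tsirelson_norm V" by (rule tsirelson_norm_admissible[OF VWD(1) adm])
  finally have T: "(\<Sum>i\<in>F. \<Sum>j<n. cmod (V i) * cmod (w j i)) \<le> 2" using VWD(2) by simp
  have "(\<Sum>i\<in>F. (cmod (D i))\<^sup>2) \<le> (\<Sum>i\<in>F. 8 * ((\<Sum>j<n. (cmod (b j))\<^sup>2 * (cmod (v j i) * cmod (W i)))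
      + (\<Sum>j<n. cmod (V i) * cmod (w j i))))"
    by (intro sum_mono pt)
  \<comment> \<open>The sum is at most 8 * (1 + 2) = 24.\<close>
  also have "\<dots> \<le> 5\<^sup>2" using S T by (simp add: sum_distrib_left[symmetric] sum.distrib)
  finally have le: "L2_set (\<lambda>i. cmod (D i)) F \<le> 5" unfolding L2_set_def by (intro real_le_lsqrt) (auto intro: sum_nonneg)
  have "D i = 0" if "i \<notin> F" for i
  proof -
    have "u j i = 0" if "j < n" for j using \<open>i \<notin> F\<close> that by (auto simp: F_def supp_def)
    then show ?thesis by (simp add: D_def U_def)
  qed
  then have "supp D \<subseteq> F" by (auto simp: supp_def)
  from ell2_finite_supp[OF F this] le show "D \<in> ell2" "ell2_norm D \<le> 5" by simp_all
qed

section \<open>Block sequences\<close>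

lemma normalized_blocksD:
  assumes u: "normalized_blocks u"
  shows "u j \<in> c00" "ell2_norm (u j) = 1" "finite (supp (u j))" "supp (u j) \<noteq> {}"
    and "i < j \<Longrightarrow> Max (supp (u i)) < Min (supp (u j))"
    and "j \<le> Min (supp (u j))"
proof -
  show c: "u j \<in> c00" "ell2_norm (u j) = 1" for j using u by (auto simp: normalized_blocks_def)
  show fin: "finite (supp (u j))" for j using c by (simp add: c00_def)
  \<comment> \<open>Norm one excludes empty supports, on which \<open>Max\<close> and
    \<open>Min\<close> would be unspecified.\<close>
  show ne: "supp (u j) \<noteq> {}" for j
  proof
    assume "supp (u j) = {}"
    then have "u j = (\<lambda>_. 0)" by (auto simp: supp_def)
    then show False using c(2)[of j] by (simp add: ell2_norm_zero)
  qed
  have step: "Max (supp (u j)) < Min (supp (u (Suc j)))" for j using u by (auto simp: normalized_blocks_def)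
  have mm: "Min (supp (u j)) \<le> Max (supp (u j))" for j using fin ne by simp
  show "Max (supp (u i)) < Min (supp (u j))" if "i < j"
    using that
  proof (induction j)
    case (Suc j)
    then show ?case using step[of j] mm[of j] by (cases "i = j") auto
  qed simp
  \<comment> \<open>The minima increase by at least one per block; this makes blocks with large
    index admissible.\<close>
  show "j \<le> Min (supp (u j))"
  proof (induction j)
    case (Suc j)
    then show ?case using step[of j] mm[of j] by simp
  qed simp
qed

lemma blocks_disjoint:
  assumes u: "normalized_blocks u" and "i \<noteq> j"
  shows "supp (u i) \<inter> supp (u j) = {}"
proof -
  note bl = normalized_blocksD[OF u]
  have "p < r" if "p \<in> supp (u i)" "r \<in> supp (u j)" "i < j" for p r i j
    using bl(5)[OF that(3)] Max_ge[OF bl(3) that(1)] Min_le[OF bl(3) that(2)] by linarith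
  then show ?thesis using \<open>i \<noteq> j\<close> by (metis disjoint_iff linorder_neqE_nat less_irrefl)
qed

text \<open>The first block used has index above \<open>n\<close>, and its support starts no earlier
  than that index.\<close>

lemma blocks_admissible:
  assumes u: "normalized_blocks u" and k: "strict_mono_on {..<n} k" "\<And>j. j < n \<Longrightarrow> n < k j" and "1 \<le> n"
  shows "admissible n (\<lambda>j. supp (u (k j)))"
  unfolding admissible_def
proof (intro conjI allI impI ballI)
  note bl = normalized_blocksD[OF u]
  show "1 \<le> n" by fact
  show "finite (supp (u (k j)))" "supp (u (k j)) \<noteq> {}" for j by (rule bl)+
  show "n \<le> Suc i" if "i \<in> supp (u (k 0))" for i
    using bl(6)[of "k 0"] Min_le[OF bl(3) that] k(2)[of 0] \<open>1 \<le> n\<close> by linarith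
  show "Max (supp (u (k j))) < Min (supp (u (k (Suc j))))" if "Suc j < n" for j
    using strict_mono_onD[OF k(1), of j "Suc j"] that by (intro bl(5)) simp
qed

text \<open>Blocks with distinct indices have disjoint supports and norm one, so they are
  orthonormal and coefficients are mapped isometrically.\<close>

lemma ell2_norm_blocks:
  fixes k :: "nat \<Rightarrow> nat"
  assumes u: "normalized_blocks u" and k: "inj_on k {..<n}"
  shows "(\<lambda>i. \<Sum>j<n. c j * u (k j) i) \<in> c00"
    and "ell2_norm (\<lambda>i. \<Sum>j<n. c j * u (k j) i) = L2_set (\<lambda>j. cmod (c j)) {..<n}"
proof -
  note bl = normalized_blocksD[OF u]
  define F where "F = (\<Union>j<n. supp (u (k j)))"
  have F: "finite F" unfolding F_def by (intro finite_UN_I finite_lessThan bl(3))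
  have sub: "supp (\<lambda>i. \<Sum>j<n. c j * u (k j) i) \<subseteq> F"
    by (auto simp: F_def supp_def intro: sum.not_neutral_contains_not_neutral)
  then show "(\<lambda>i. \<Sum>j<n. c j * u (k j) i) \<in> c00" using F by (auto simp: c00_def intro: finite_subset)
  have disj: "supp (u (k i)) \<inter> supp (u (k j)) = {}" if "i < n" "j < n" "i \<noteq> j" for i j
    using that k by (intro blocks_disjoint[OF u]) (auto dest: inj_onD)
  have val: "(\<Sum>j<n. c j * u (k j) i) = c m * u (k m) i" if "m < n" "i \<in> supp (u (k m))" for m i
    using that disj[of _ m] by (intro sum_single) (auto simp: supp_def)
  have one: "(\<Sum>i\<in>supp (u j). (cmod (u j i))\<^sup>2) = 1" for j
    using ell2_finite_supp(2)[OF bl(3) order_refl, of j] bl(2)[of j] by (simp add: L2_set_def)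
  have "(\<Sum>i\<in>F. (cmod (\<Sum>j<n. c j * u (k j) i))\<^sup>2)
      = (\<Sum>m<n. \<Sum>i\<in>supp (u (k m)). (cmod (\<Sum>j<n. c j * u (k j) i))\<^sup>2)"
    unfolding F_def using bl(3) disj by (intro sum.UNION_disjoint) auto
  also have "\<dots> = (\<Sum>m<n. \<Sum>i\<in>supp (u (k m)). (cmod (c m))\<^sup>2 * (cmod (u (k m) i))\<^sup>2)"
    by (intro sum.cong refl) (simp add: val norm_mult power_mult_distrib)
  also have "\<dots> = (\<Sum>m<n. (cmod (c m))\<^sup>2)" by (simp add: sum_distrib_left[symmetric] one)
  finally show "ell2_norm (\<lambda>i. \<Sum>j<n. c j * u (k j) i) = L2_set (\<lambda>j. cmod (c j)) {..<n}"
    using ell2_finite_supp(2)[OF F sub] by (simp add: L2_set_def)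
qed

lemma supp_add_kp:
  assumes "supp a \<subseteq> F" "supp b \<subseteq> F" shows "supp (\<lambda>j. a j + 2 * kp b j) \<subseteq> F"
proof
  fix j assume j: "j \<in> supp (\<lambda>j. a j + 2 * kp b j)"
  show "j \<in> F"
  proof (rule ccontr)
    assume "j \<notin> F"
    then have "a j = 0" "b j = 0" using assms by (auto simp: supp_def)
    then have "a j + 2 * kp b j = 0" by (simp add: kp_def kp_unit_def)
    then show False using j by (simp add: supp_def)
  qed
qed

text \<open>Up to an error of norm at most \<open>5 * ell2_norm b\<close>, the vector in the first
  term is the block vector with coefficients \<open>a + 2 * kp b\<close>, whose norm is that of its
  coefficients.\<close>

lemma twisted_value_estimate:
  assumes B: "selection tsirelson_norm B" and u: "normalized_blocks u"
    and supp: "supp a \<subseteq> {..<n}" "supp b \<subseteq> {..<n}"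
    and k: "strict_mono_on {..<n} k" "\<And>j. j < n \<Longrightarrow> n < k j"
  shows "\<bar>twisted_value (centralizer B) u n a b k - (ell2_norm (\<lambda>j. a j + 2 * kp b j) + ell2_norm b)\<bar>
      \<le> 5 * ell2_norm b"
    and "ell2_norm b \<le> twisted_value (centralizer B) u n a b k"
proof -
  note bl = normalized_blocksD[OF u]
  define L where "L = centralizer B"
  define c where "c = ell2_norm b"
  have inj: "inj_on k {..<n}" using k(1) by (rule strict_mono_on_imp_inj_on)
  note bn = ell2_norm_blocks[OF u inj]
  have b2: "b \<in> ell2" and c_eq: "c = L2_set (\<lambda>j. cmod (b j)) {..<n}"
    unfolding c_def using ell2_finite_supp[OF finite_lessThan supp(2)] by auto
  have c0: "0 \<le> c" unfolding c_def by (rule ell2_norm_nonneg[OF b2])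
  have "supp (\<lambda>j. a j + 2 * kp b j) \<subseteq> {..<n}" by (rule supp_add_kp[OF supp])
  from ell2_finite_supp(2)[OF finite_lessThan this]
  have Y: "ell2_norm (\<lambda>i. \<Sum>j<n. (a j + 2 * kp b j) * u (k j) i) = ell2_norm (\<lambda>j. a j + 2 * kp b j)"
    by (simp add: bn(2))
  have Ub: "ell2_norm (\<lambda>i. \<Sum>j<n. b j * u (k j) i) = c" by (simp add: bn(2) c_eq)
  have "\<forall>j. \<exists>v w. lozanovskii_factorization tsirelson_norm (u j) v w \<and>
      L (u j) = (\<lambda>i. u j i * complex_of_real (ln (cmod (w i)) - ln (cmod (v i))))"
  proof
    fix j
    obtain v w where vw: "lozanovskii_factorization tsirelson_norm (u j) v w"
      and "\<forall>c. centralizer B (\<lambda>i. c * u j i)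
        = (\<lambda>i. c * (u j i * complex_of_real (ln (cmod (w i)) - ln (cmod (v i)))))"
      using centralizer_finite[OF B bl(1,2)[of j]] by blast
    from this(2)[rule_format, of 1]
    show "\<exists>v w. lozanovskii_factorization tsirelson_norm (u j) v w \<and>
      L (u j) = (\<lambda>i. u j i * complex_of_real (ln (cmod (w i)) - ln (cmod (v i))))"
      using vw unfolding L_def by (intro exI[of _ v] exI[of _ w]) simp
  qed
  then obtain v w where vw: "\<And>j. lozanovskii_factorization tsirelson_norm (u j) (v j) (w j)"
    and Lu: "\<And>j. L (u j) = (\<lambda>i. u j i * complex_of_real (ln (cmod (w j i)) - ln (cmod (v j i))))"
    by metis
  define X where "X = (\<lambda>i. (\<Sum>j<n. a j * u (k j) i) + (\<Sum>j<n. b j * L (u (k j)) i)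
                     - L (\<lambda>i. \<Sum>j<n. b j * u (k j) i) i)"
  have "\<exists>D. D \<in> ell2 \<and> ell2_norm D \<le> 5 \<and>
      (\<forall>i. X i - (\<Sum>j<n. (a j + 2 * kp b j) * u (k j) i) = - complex_of_real c * D i)"
  proof (cases "c = 0")
    case True
    then have b0: "b = (\<lambda>_. 0)" using ell2_norm_eq_0D[OF b2] by (simp add: c_def)
    \<comment> \<open>Scalar 0 in the formula for any normalized block shows that the centralizer
      vanishes at the zero vector.\<close>
    obtain v w where "\<forall>c. centralizer B (\<lambda>i. c * u 0 i)
        = (\<lambda>i. c * (u 0 i * complex_of_real (ln (cmod (w i)) - ln (cmod (v i)))))"
      using centralizer_finite[OF B bl(1,2)[of 0]] by blast
    from this[rule_format, of 0] have "L (\<lambda>_. 0) = (\<lambda>_. 0)" by (simp add: L_def)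
    moreover have "kp b j = 0" for j by (simp add: kp_eq[OF b2]) (simp add: b0)
    ultimately have "X i - (\<Sum>j<n. (a j + 2 * kp b j) * u (k j) i) = - complex_of_real c * 0" for i
      by (simp add: X_def b0)
    then show ?thesis
      by (intro exI[of _ "\<lambda>_. 0"]) (use c00_ell2[OF zero_c00] ell2_norm_zero in simp)
  next
    case False
    then have c: "0 < c" using c0 by simp
    \<comment> \<open>The defect \<open>D\<close> is computed for the normalized coefficients and
      scaled back by \<open>c\<close>.\<close>
    define \<beta> where "\<beta> = (\<lambda>j. b j / complex_of_real c)"
    have b_eq: "b j = complex_of_real c * \<beta> j" for j using c by (simp add: \<beta>_def)
    have kp: "kp b j = complex_of_real c * (\<beta> j * complex_of_real (ln (cmod (\<beta> j))))" for j
      by (simp add: kp_def kp_unit_def \<beta>_def c_def)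
    define U where "U = (\<lambda>i. \<Sum>j<n. \<beta> j * u (k j) i)"
    have "cmod (b j) = c * cmod (\<beta> j)" for j using c by (simp add: b_eq norm_mult)
    with c_eq have "c = L2_set (\<lambda>j. c * cmod (\<beta> j)) {..<n}" by simp
    then have \<beta>1: "L2_set (\<lambda>j. cmod (\<beta> j)) {..<n} = 1" using c by (simp add: L2_set_right_distrib[symmetric])
    have U: "U \<in> c00" "ell2_norm U = 1" unfolding U_def bn(2) \<beta>1 by (rule bn(1)) simp
    have \<beta>2: "(\<Sum>j<n. (cmod (\<beta> j))\<^sup>2) = 1" using \<beta>1 by (simp add: L2_set_def)
    obtain V W where VW: "lozanovskii_factorization tsirelson_norm U V W"
      and LU: "\<forall>c. centralizer B (\<lambda>i. c * U i)
        = (\<lambda>i. c * (U i * complex_of_real (ln (cmod (W i)) - ln (cmod (V i)))))"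
      using centralizer_finite[OF B U] by blast
    \<comment> \<open>\<open>admissible\<close> demands a nonempty family, which
      \<open>c > 0\<close> ensures.\<close>
    have "1 \<le> n" using c c_eq by (cases n) auto
    note adm = blocks_admissible[OF u k this]
    define D where "D = (\<lambda>i. U i * complex_of_real (ln (cmod (W i)) - ln (cmod (V i)))
      - (\<Sum>j<n. \<beta> j * (u (k j) i * complex_of_real (ln (cmod (w (k j) i)) - ln (cmod (v (k j) i)))))
      + 2 * (\<Sum>j<n. \<beta> j * complex_of_real (ln (cmod (\<beta> j))) * u (k j) i))"
    have D: "D \<in> ell2" "ell2_norm D \<le> 5"
      using factorization_almost_linear[where u = "\<lambda>j. u (k j)" and v = "\<lambda>j. v (k j)" and w = "\<lambda>j. w (k j)",
          OF adm \<beta>2 bl(1) vw VW[unfolded U_def]]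
      unfolding D_def U_def by simp_all
    have "(\<lambda>i. \<Sum>j<n. b j * u (k j) i) = (\<lambda>i. complex_of_real c * U i)"
      unfolding U_def b_eq by (simp add: sum_distrib_left mult.assoc)
    then have "L (\<lambda>i. \<Sum>j<n. b j * u (k j) i)
        = (\<lambda>i. complex_of_real c * (U i * complex_of_real (ln (cmod (W i)) - ln (cmod (V i)))))"
      by (simp only: L_def LU[rule_format])
    then have "X i - (\<Sum>j<n. (a j + 2 * kp b j) * u (k j) i) = - complex_of_real c * D i" for i
      unfolding X_def D_def kp Lu
      by (simp add: b_eq sum_distrib_left sum.distrib sum_subtractf sum_negf algebra_simps)
    then show ?thesis using D by blast
  qed
  then obtain D where D: "D \<in> ell2" "ell2_norm D \<le> 5"
    and XD: "\<And>i. X i - (\<Sum>j<n. (a j + 2 * kp b j) * u (k j) i) = - complex_of_real c * D i" by blast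
  note cD = ell2_scale[OF D(1), of "- complex_of_real c"]
  have Y2: "(\<lambda>i. \<Sum>j<n. (a j + 2 * kp b j) * u (k j) i) \<in> ell2" by (rule c00_ell2[OF bn(1)])
  have "X = (\<lambda>i. - complex_of_real c * D i + (\<Sum>j<n. (a j + 2 * kp b j) * u (k j) i))"
    using XD by (auto simp: fun_eq_iff diff_eq_eq)
  then have X2: "X \<in> ell2" using ell2_add(1)[OF cD(1) Y2] by simp
  have "\<bar>ell2_norm X - ell2_norm (\<lambda>j. a j + 2 * kp b j)\<bar> \<le> c * ell2_norm D"
    using ell2_norm_diff_ge[OF X2 Y2] cD(2) c0 unfolding XD Y by simp
  also have "\<dots> \<le> 5 * c" using mult_left_mono[OF D(2) c0] by simp
  finally have "\<bar>ell2_norm X - ell2_norm (\<lambda>j. a j + 2 * kp b j)\<bar> \<le> 5 * c" .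
  moreover have "twisted_value L u n a b k = ell2_norm X + c" by (simp add: twisted_value_def X_def Ub)
  ultimately show "\<bar>twisted_value (centralizer B) u n a b k - (ell2_norm (\<lambda>j. a j + 2 * kp b j) + ell2_norm b)\<bar>
      \<le> 5 * ell2_norm b" "ell2_norm b \<le> twisted_value (centralizer B) u n a b k"
    using ell2_norm_nonneg[OF X2] by (simp_all add: L_def[symmetric] c_def[symmetric])
qed

text \<open>\<open>L\<close> and \<open>P\<close> differ by at most \<open>5 * ell2_norm b\<close>,
  and both are at least \<open>ell2_norm b\<close>; hence the factor 6 in each direction.\<close>

lemma twisted_limit_equivalent:
  assumes B: "selection tsirelson_norm B" and u: "normalized_blocks u"
    and supp: "supp a \<subseteq> {..<n}" "supp b \<subseteq> {..<n}" and L: "twisted_limit (centralizer B) u n a b L"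
  defines "P \<equiv> ell2_norm (\<lambda>j. a j + 2 * kp b j) + ell2_norm b"
  shows "L \<le> 6 * P" "P \<le> 6 * L"
proof -
  have b2: "b \<in> ell2" "a \<in> ell2" using ell2_finite_supp(1) supp by blast+
  have "supp (\<lambda>j. a j + 2 * kp b j) \<subseteq> {..<n}" by (rule supp_add_kp[OF supp])
  then have "(\<lambda>j. a j + 2 * kp b j) \<in> ell2" by (rule ell2_finite_supp(1)[OF finite_lessThan])
  then have nn: "0 \<le> ell2_norm (\<lambda>j. a j + 2 * kp b j)" by (rule ell2_norm_nonneg)
  have approx: "\<bar>L - P\<bar> \<le> 5 * ell2_norm b + e \<and> ell2_norm b \<le> L + e" if "e > 0" for e
  proof -
    obtain \<nu> where \<nu>: "\<And>k. strict_mono_on {..<n} k \<Longrightarrow> (\<forall>j<n. \<nu> < k j) \<Longrightarrow>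
        \<bar>twisted_value (centralizer B) u n a b k - L\<bar> < e"
      using L \<open>e > 0\<close> unfolding twisted_limit_def by blast
    \<comment> \<open>Indices beyond \<nu> make the value close to the limit, and indices beyond
      \<open>n\<close> make the blocks admissible.\<close>
    define k where "k = (\<lambda>j. Suc (\<nu> + n + j))"
    have k: "strict_mono_on {..<n} k" "\<And>j. n < k j" "\<forall>j<n. \<nu> < k j"
      by (auto simp: k_def strict_mono_on_def)
    show ?thesis
      using \<nu>[OF k(1,3)] twisted_value_estimate[OF B u supp k(1,2)] unfolding P_def by linarith
  qed
  have 1: "\<bar>L - P\<bar> \<le> 5 * ell2_norm b" by (rule field_le_epsilon) (use approx in blast)
  have 2: "ell2_norm b \<le> L" by (rule field_le_epsilon) (use approx in blast)
  have "ell2_norm b \<le> P" using nn by (simp add: P_def)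
  then show "L \<le> 6 * P" "P \<le> 6 * L" using 1 2 by (simp_all add: abs_le_iff)
qed

theorem theorem3:
  fixes B :: "cseq \<Rightarrow> complex \<Rightarrow> cseq"
    and S :: "(nat \<Rightarrow> cseq \<times> cseq) set qnspace"
  assumes "selection tsirelson_norm B"
    and "twisted_spreading_model (centralizer B) S"
  shows "qn_isomorphic S kalton_peck"
proof -
  obtain u N where u: "normalized_blocks u"
    and N: "\<And>n a b. supp a \<subseteq> {..<n} \<Longrightarrow> supp b \<subseteq> {..<n} \<Longrightarrow> twisted_limit (centralizer B) u n a b (N (a, b))"
    and S: "S = qcompletion (twisted_presp N)"
    using assms(2) unfolding twisted_spreading_model_def by blast
  have equiv: "N (a, b) \<le> 6 * (ell2_norm (\<lambda>j. a j + 2 * kp b j) + ell2_norm b)"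
    "ell2_norm (\<lambda>j. a j + 2 * kp b j) + ell2_norm b \<le> 6 * N (a, b)"
    if ab: "a \<in> c00" "b \<in> c00" for a b
  proof -
    obtain n where "supp a \<union> supp b \<subseteq> {..<n}"
      using ab finite_nat_bounded[of "supp a \<union> supp b"] by (auto simp: c00_def)
    then have "supp a \<subseteq> {..<n}" "supp b \<subseteq> {..<n}" by auto
    from twisted_limit_equivalent[OF assms(1) u this N[OF this]]
    show "N (a, b) \<le> 6 * (ell2_norm (\<lambda>j. a j + 2 * kp b j) + ell2_norm b)"
      "ell2_norm (\<lambda>j. a j + 2 * kp b j) + ell2_norm b \<le> 6 * N (a, b)" .
  qed
  \<comment> \<open>With first component - a / 2, subtracting \<open>kp b\<close> gives - 1/2 times
    \<open>a + 2 * kp b\<close>, the vector in the limit quasi-norm.\<close>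
  define J where "J = (\<lambda>(a::cseq, b::cseq). (\<lambda>j. (- 1 / 2) * a j, b))"
  have J_norm: "qnorm kalton_peck (J (a, b)) = ell2_norm (\<lambda>j. a j + 2 * kp b j) / 2 + ell2_norm b"
    if ab: "a \<in> c00" "b \<in> c00" for a b
  proof -
    have e: "(\<lambda>j. a j + 2 * kp b j) \<in> ell2"
      by (intro c00_ell2 c00_add c00_scale kp_c00 ab)
    have "(\<lambda>j. (- 1 / 2) * a j - kp b j) = (\<lambda>j. (- 1 / 2) * (a j + 2 * kp b j))"
      by (auto simp: fun_eq_iff field_simps)
    then show ?thesis using ell2_scale(2)[OF e, of "- 1 / 2"]
      by (simp add: J_def kalton_peck_simps norm_divide)
  qed
  \<comment> \<open>Write A for the norm of \<open>a + 2 * kp b\<close> and B for that of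
    \<open>b\<close>. The image has quasi-norm A / 2 + B, which lies between (A + B) / 2 and A + B;
    combined with the factor 6 from \<open>equiv\<close> this gives 1/12 and 6.\<close>
  interpret dense_embedding kalton_peck 7 "twisted_presp N" J "1 / 12" 6
  proof
    show "(0::real) < 1 / 12" "(0::real) < 6" by simp_all
  next
    fix p assume p: "p \<in> qcarrier (twisted_presp N)"
    obtain a b where ab: "p = (a, b)" "a \<in> c00" "b \<in> c00" using p by (auto simp: twisted_presp_def)
    have nn: "0 \<le> ell2_norm b" "0 \<le> ell2_norm (\<lambda>j. a j + 2 * kp b j)"
      by (intro ell2_norm_nonneg c00_ell2 c00_add c00_scale kp_c00 ab)+
    show "qscale (twisted_presp N) c p \<in> qcarrier (twisted_presp N)" for c
      using ab by (simp add: twisted_presp_def c00_scale)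
    show "J p \<in> qcarrier kalton_peck"
      using c00_kalton_peck[OF c00_scale[OF ab(2)] ab(3)] unfolding ab(1) J_def prod.case .
    show "J (qscale (twisted_presp N) c p) = qscale kalton_peck c (J p)" for c
      by (simp add: ab J_def twisted_presp_def kalton_peck_simps)
    show "1 / 12 * qnorm (twisted_presp N) p \<le> qnorm kalton_peck (J p)"
      using equiv[OF ab(2,3)] J_norm[OF ab(2,3)] nn by (simp add: ab(1) twisted_presp_def)
    show "qnorm kalton_peck (J p) \<le> 6 * qnorm (twisted_presp N) p"
      using equiv[OF ab(2,3)] J_norm[OF ab(2,3)] nn by (simp add: ab(1) twisted_presp_def)
    fix r assume r: "r \<in> qcarrier (twisted_presp N)"
    obtain a' b' where ab': "r = (a', b')" "a' \<in> c00" "b' \<in> c00" using r by (auto simp: twisted_presp_def)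
    show "qadd (twisted_presp N) p r \<in> qcarrier (twisted_presp N)"
      using ab ab' by (simp add: twisted_presp_def c00_add)
    show "J (qadd (twisted_presp N) p r) = qadd kalton_peck (J p) (J r)"
      by (simp add: ab ab' J_def twisted_presp_def kalton_peck_simps fun_eq_iff field_simps)
  next
    fix z assume z: "z \<in> qcarrier kalton_peck"
    obtain x y where xy: "z = (x, y)" by (metis surj_pair)
    \<comment> \<open>The factor - 2 cancels the - 1/2 in \<open>J\<close>, so the images are the
      truncations of \<open>z\<close>.\<close>
    define s where "s = (\<lambda>n. (\<lambda>j. - 2 * restr {..<n} x j, restr {..<n} y))"
    have "J (s n) = (restr {..<n} x, restr {..<n} y)" for n by (simp add: J_def s_def)
    moreover have "s n \<in> qcarrier (twisted_presp N)" for n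
      unfolding s_def twisted_presp_def using c00_scale[OF restr_c00, of "{..<n}" "- 2" x]
      by (simp add: restr_c00)
    ultimately show "\<exists>s. (\<forall>n. s n \<in> qcarrier (twisted_presp N)) \<and> (\<lambda>n. qdist kalton_peck (J (s n)) z) \<longlonglongrightarrow> 0"
      using kalton_peck_truncation z unfolding xy by (intro exI[of _ s]) simp
  qed
  show ?thesis unfolding S by (rule qcompletion_isomorphic)
qed

end
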